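(* Consider the setting described in the context. Let $(\hat\Phi,\hat F^{(H+1)})$ denote the learned representation and target task weights, $\hat K=\hat F^{(H+1)}\hat\Phi$, and let $$\mathrm{ER}(\hat\Phi,\hat F^{(H+1)})=\frac1{2T}\mathbb E\left[\sum_{t=0}^{T-1}\|(K^{(H+1)}-\hat K)x_\star[t]\|^2\right]$$ denote the corresponding excess risk (expectation over expert target task trajectories $x_\star$, with $\hat K$ held fixed). Define $A_{\mathsf{cl}}:=A+BK^{(H+1)}$. Assume that $$\mathrm{ER}(\hat\Phi,\hat F^{(H+1)})\lesssim\frac{\lambda_{\min}(\Sigma_x^{(H+1)})}{\mathcal J(A_{\mathsf{cl}})^2\|B\|^2}.$$ Then with probability greater than $1-\delta$, for a new target task trajectory sampled with process randomness $x[0]\sim\mathcal N(0,\Sigma_x^{(H+1)})$, $z[t]\overset{\mathrm{i.i.d.}}{\sim}\mathcal N(0,\sigma_z^2I)$, $w[t]\overset{\mathrm{i.i.d.}}{\sim}\mathcal N(0,\Sigma_w^{(H+1)})$, $t=0,\dots,T-1$, the tracking error satisfies $$\max_{1\le t\le T}\|\hat x[t]-x_\star[t]\|^2\lesssim\mathcal J(A_{\mathsf{cl}})^2\|B\|^2\log\!\left(\frac T\delta\right)\mathrm{ER}(\hat\Phi,\hat F^{(H+1)}).$$ Furthermore, for any cost function $h(\cdot)$ that is $L$-Lipschitz with respect to the trajectory-wise metric $d(\vec x_{1:T},\vec y_{1:T})=\max_{1\le t\le T}\|x[t]-y[t]\|$, $$\left|\mathbb E_{\hat{\mathcal P}_{1:T}}[h(\hat{\vec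 x}_{1:T})]-\mathbb E_{\mathcal P^\star_{1:T}}[h(\vec x^\star_{1:T})]\right|\lesssim L\,\mathcal J(A_{\mathsf{cl}})\|B\|\sqrt{\log T}\,\sqrt{\mathrm{ER}(\hat\Phi,\hat F^{(H+1)})}.$$
   Context: Notation: $\|\cdot\|$ is the Euclidean/spectral norm; $\rho$ is the spectral radius; for $\rho(M)<1$, $\mathcal J(M):=\sum_{t\ge0}\|M^t\|$. $a\lesssim b$ means $a\le Cb$ for a universal constant $C>0$. Setting: $A\in\mathbb R^{n_x\times n_x}$, $B\in\mathbb R^{n_x\times n_u}$; the expert target controller is $K^{(H+1)}=F_\star^{(H+1)}\Phi_\star$ with $F_\star^{(H+1)}\in\mathbb R^{n_u\times k}$, $\Phi_\star\in\mathbb R^{k\times n_x}$, $2k\le n_x$, and $\rho(A+BK^{(H+1)})<1$. $\Sigma_w^{(H+1)}\succ0$, $\sigma_z^2>0$, and $\Sigma_x^{(H+1)}$ solves $\Sigma_x^{(H+1)}=A_{\mathsf{cl}}\Sigma_x^{(H+1)}A_{\mathsf{cl}}^\top+\sigma_z^2BB^\top+\Sigma_w^{(H+1)}$ with $A_{\mathsf{cl}}=A+BK^{(H+1)}$. The learned $\hat\Phi\in\mathbb R^{k\times n_x}$, $\hat F^{(H+1)}\in\mathbb R^{n_u\times k}$ are computed from training data (by empirical risk minimization over source and target expert demonstrations), which are independent of the new trajectory. Coupled closed-loop systems: for the same realization of $x[0],z[t],w[t]$, $$x_\star[t+1]=(A+BK^{(H+1)})x_\star[t]+Bz[t]+w[t],\quad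 x_\star[0]=x[0],$$ $$\hat x[t+1]=(A+B\hat K)\hat x[t]+Bz[t]+w[t],\quad \hat x[0]=x[0].$$ $\mathcal P^\star_{1:T}$ and $\hat{\mathcal P}_{1:T}$ are the distributions of $\vec x^\star_{1:T}=(x_\star[1],\dots,x_\star[T])$ and $\hat{\vec x}_{1:T}=(\hat x[1],\dots,\hat x[T])$, with $\hat K$ held fixed. Under the expert, each $x_\star[t]$ has marginal distribution $\mathcal N(0,\Sigma_x^{(H+1)})$.
   Formalization: The expectation bound is stated for T ≥ 2 only (for T = 1, log T = 0 would force equal expectations, which is false), and for T = 1 the high-probability bound is stated only for δ ≤ 1/2, since no universal constant works as δ → 1. *)

theory Defs
  imports "HOL-Probability.Probability" "Jordan_Normal_Form.Spectral_Radius"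
begin

text \<open>
  Vectors and matrices are those of Jordan_Normal_Form, whose dimensions are terms and not
  types: the universal constants of the theorem must not depend on the dimensions, so the
  dimensions have to be quantified inside the scope of the constants.
\<close>

subsection \<open>Norms and spectral quantities\<close>

definition euclid_norm :: "real Matrix.vec \<Rightarrow> real" where
  "euclid_norm v = sqrt (v \<bullet> v)"

definition spectral_norm :: "real Matrix.mat \<Rightarrow> real" where
  "spectral_norm M =
     (SUP x\<in>{x \<in> carrier_vec (dim_col M). euclid_norm x \<le> 1}. euclid_norm (M *\<^sub>v x))"

definition \<J> :: "real Matrix.mat \<Rightarrow> real" where
  "\<J> M = (\<Sum>t. spectral_norm (M ^\<^sub>m t))"

text \<open>Only used for symmetric matrices, all of whose eigenvalues are real.\<close>

definition lambda_min :: "real Matrix.mat \<Rightarrow> real" where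
  "lambda_min S = Min (spectrum S)"

definition pos_def :: "nat \<Rightarrow> real Matrix.mat \<Rightarrow> bool" where
  "pos_def n S \<longleftrightarrow> S \<in> carrier_mat n n \<and> transpose_mat S = S \<and>
     (\<forall>v\<in>carrier_vec n. v \<noteq> 0\<^sub>v n \<longrightarrow> 0 < v \<bullet> (S *\<^sub>v v))"

subsection \<open>Gaussian vectors\<close>

text \<open>The Borel sigma-algebra of Euclidean n-space, generated by the coordinates.\<close>

definition borel_vec :: "nat \<Rightarrow> real Matrix.vec measure" where
  "borel_vec n =
     vimage_algebra (carrier_vec n) (\<lambda>v. \<lambda>i\<in>{..<n}. v $ i) (\<Pi>\<^sub>M i\<in>{..<n}. borel)"

text \<open>
  The law N(0,S) for positive definite S: every nontrivial linear functional a is normally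
  distributed with mean 0 and variance \<open>a \<bullet> S a\<close> (the library's \<open>normal_density\<close> takes the
  standard deviation).
\<close>

definition centered_gaussian :: "nat \<Rightarrow> real Matrix.mat \<Rightarrow> real Matrix.vec measure \<Rightarrow> bool" where
  "centered_gaussian n S \<mu> \<longleftrightarrow> prob_space \<mu> \<and> sets \<mu> = sets (borel_vec n) \<and>
     (\<forall>a\<in>carrier_vec n. a \<noteq> 0\<^sub>v n \<longrightarrow>
        distributed \<mu> lborel (\<lambda>x. a \<bullet> x) (normal_density 0 (sqrt (a \<bullet> (S *\<^sub>v a)))))"

subsection \<open>Closed-loop trajectories\<close>

text \<open>A realization of the process randomness: \<open>(x[0], z, w)\<close>.\<close>

type_synonym noise = "real Matrix.vec \<times> (nat \<Rightarrow> real Matrix.vec) \<times> (nat \<Rightarrow> real Matrix.vec)"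

text \<open>
  \<open>x[0], z[0], \<dots>, z[T-1], w[0], \<dots>, w[T-1]\<close> are independent with \<open>x[0] \<sim> \<mu>x\<close>, \<open>z[t] \<sim> \<mu>z\<close>,
  \<open>w[t] \<sim> \<mu>w\<close>.
\<close>

definition noise_law ::
  "nat \<Rightarrow> real Matrix.vec measure \<Rightarrow> real Matrix.vec measure \<Rightarrow> real Matrix.vec measure \<Rightarrow> noise measure"
  where
  "noise_law T \<mu>x \<mu>z \<mu>w = \<mu>x \<Otimes>\<^sub>M ((\<Pi>\<^sub>M t\<in>{..<T}. \<mu>z) \<Otimes>\<^sub>M (\<Pi>\<^sub>M t\<in>{..<T}. \<mu>w))"

fun closed_loop ::
  "real Matrix.mat \<Rightarrow> real Matrix.mat \<Rightarrow> real Matrix.mat \<Rightarrow> noise \<Rightarrow> nat \<Rightarrow> real Matrix.vec" where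
  "closed_loop A B K (x0, z, w) 0 = x0"
| "closed_loop A B K (x0, z, w) (Suc t) =
     (A + B * K) *\<^sub>v closed_loop A B K (x0, z, w) t + B *\<^sub>v z t + w t"

definition excess_risk ::
  "noise measure \<Rightarrow> nat \<Rightarrow> real Matrix.mat \<Rightarrow> real Matrix.mat \<Rightarrow> real Matrix.mat \<Rightarrow> real Matrix.mat \<Rightarrow> real"
  where
  "excess_risk P T A B K K' =
     1 / (2 * real T) *
       (\<integral>\<omega>. (\<Sum>t<T. (euclid_norm ((K - K') *\<^sub>v closed_loop A B K \<omega> t))\<^sup>2) \<partial>P)"

definition traj_space :: "nat \<Rightarrow> nat \<Rightarrow> (nat \<Rightarrow> real Matrix.vec) measure" where
  "traj_space n T = (\<Pi>\<^sub>M t\<in>{1..T}. borel_vec n)"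

text \<open>The law of \<open>(x[1], \<dots>, x[T])\<close>.\<close>

definition traj_law ::
  "nat \<Rightarrow> nat \<Rightarrow> noise measure \<Rightarrow> real Matrix.mat \<Rightarrow> real Matrix.mat \<Rightarrow> real Matrix.mat \<Rightarrow>
     (nat \<Rightarrow> real Matrix.vec) measure" where
  "traj_law n T P A B K =
     distr P (traj_space n T) (\<lambda>\<omega>. \<lambda>t\<in>{1..T}. closed_loop A B K \<omega> t)"

definition traj_dist :: "nat \<Rightarrow> (nat \<Rightarrow> real Matrix.vec) \<Rightarrow> (nat \<Rightarrow> real Matrix.vec) \<Rightarrow> real" where
  "traj_dist T x y = (MAX t\<in>{1..T}. euclid_norm (x t - y t))"

definition traj_lipschitz ::
  "nat \<Rightarrow> nat \<Rightarrow> real \<Rightarrow> ((nat \<Rightarrow> real Matrix.vec) \<Rightarrow> real) \<Rightarrow> bool" where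
  "traj_lipschitz n T L h \<longleftrightarrow> 0 \<le> L \<and>
     (\<forall>x\<in>space (traj_space n T). \<forall>y\<in>space (traj_space n T). \<bar>h x - h y\<bar> \<le> L * traj_dist T x y)"

end

theory Submission
  imports Defs
begin

text \<open>
  With \<open>D = K - K'\<close> the difference \<open>e = x\<^sub>\<star> - x'\<close> of the two trajectories satisfies
  \<open>e (t + 1) = Acl e t + B D (x\<^sub>\<star> t - e t)\<close>. Since \<open>\<tau> = tr (D \<Sigma>x D\<^sup>T) = 2 ER\<close> is at least
  \<open>lambda_min \<Sigma>x\<close> times the squared Frobenius norm of \<open>D\<close>, the smallness assumption makes the gain
  \<open>\<J> \<parallel>B\<parallel> \<parallel>D\<parallel>\<close> of the feedback of \<open>e\<close> into itself at most \<open>1/2\<close>, whence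
  \<open>\<parallel>e\<parallel> \<le> 2 \<J> \<parallel>B\<parallel> max\<^sub>t \<parallel>D x\<^sub>\<star> t\<parallel>\<close>. The law of \<open>x\<^sub>\<star> t\<close> is stationary, and convexity of the
  exponential gives \<open>E exp (\<parallel>D x\<^sub>\<star> t\<parallel>\<^sup>2 / (4 \<tau>)) \<le> sqrt 2\<close>. Markov's inequality applied to the sum over
  \<open>t\<close> of these exponentials yields the probability bound, and concavity of the logarithm the bound
  on expectations. A Lipschitz function that is not integrable under one of the two laws is not
  integrable under the other, so that both of its integrals are \<open>0\<close>.
\<close>

unbundle no vec_syntax
unbundle no inner_syntax

subsection \<open>Euclidean and spectral norms\<close>

text \<open>Stability of \<open>A + B * K'\<close> is never established: the learned trajectory is
  treated as that of the expert's loop driven by its own deviation, so only powers of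
  \<open>A + B * K\<close> occur. This is why the smallness assumption involves \<open>\<J>\<close>
  of the expert's closed-loop matrix alone. The size of \<open>D\<close> is measured in the
  Frobenius norm because \<tau> is a sum of variances over the rows of \<open>D\<close> and can be
  compared with it row by row, without any factor depending on the dimensions. States at different
  times are strongly dependent; this dependence is not analysed, since summing T exponentials costs
  a factor T inside a logarithm only. \<open>\<Sigma>x\<close> is given merely as a solution of the
  Lyapunov equation, so its symmetry and definiteness, and with them the meaning of
  \<open>lambda_min\<close>, have to be extracted from stability. All estimates with
  dimension-dependent constants serve convergence statements only and never reach the final
  constants.\<close>

lemma euclid_norm_L2: "euclid_norm v = L2_set (\<lambda>i. v $ i) {..<dim_vec v}"
  unfolding euclid_norm_def L2_set_def scalar_prod_def
  by (simp add: power2_eq_square atLeast0LessThan)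

lemma euclid_norm_nonneg [simp]: "0 \<le> euclid_norm v"
  unfolding euclid_norm_L2 by simp

lemma euclid_norm_sq: "(euclid_norm v)\<^sup>2 = v \<bullet> v"
  by (simp add: euclid_norm_def scalar_prod_def sum_nonneg)

lemma euclid_norm_sq_sum: "(euclid_norm v)\<^sup>2 = (\<Sum>i<dim_vec v. (v $ i)\<^sup>2)"
  by (simp add: euclid_norm_L2 L2_set_def sum_nonneg)

lemma euclid_norm_zero [simp]: "euclid_norm (0\<^sub>v n) = 0"
  by (simp add: euclid_norm_def)

lemma euclid_norm_eq_0: "v \<in> carrier_vec n \<Longrightarrow> euclid_norm v = 0 \<longleftrightarrow> v = 0\<^sub>v n"
  by (auto simp: euclid_norm_L2 L2_set_eq_0_iff intro!: eq_vecI)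

lemma euclid_norm_triangle:
  assumes "u \<in> carrier_vec n" "v \<in> carrier_vec n"
  shows "euclid_norm (u + v) \<le> euclid_norm u + euclid_norm v"
proof -
  have "euclid_norm (u + v) = L2_set (\<lambda>i. u $ i + v $ i) {..<n}"
    unfolding euclid_norm_L2 using assms by (auto intro!: L2_set_cong)
  also have "\<dots> \<le> L2_set (\<lambda>i. u $ i) {..<n} + L2_set (\<lambda>i. v $ i) {..<n}"
    by (rule L2_set_triangle_ineq)
  finally show ?thesis using assms by (simp add: euclid_norm_L2)
qed

lemma euclid_norm_smult: "euclid_norm (c \<cdot>\<^sub>v v) = \<bar>c\<bar> * euclid_norm v"
proof -
  have "(euclid_norm (c \<cdot>\<^sub>v v))\<^sup>2 = (\<bar>c\<bar> * euclid_norm v)\<^sup>2"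
    by (simp add: euclid_norm_sq_sum power_mult_distrib sum_distrib_left)
  thus ?thesis by (simp add: power2_eq_iff_nonneg)
qed

lemma euclid_norm_minus_commute:
  assumes "u \<in> carrier_vec n" "v \<in> carrier_vec n"
  shows "euclid_norm (u - v) = euclid_norm (v - u)"
proof -
  have "(euclid_norm (u - v))\<^sup>2 = (euclid_norm (v - u))\<^sup>2"
    using assms by (simp add: euclid_norm_sq_sum power2_commute)
  thus ?thesis by (simp add: power2_eq_iff_nonneg)
qed

lemma scalar_prod_le_euclid_norm:
  assumes "u \<in> carrier_vec n" "v \<in> carrier_vec n"
  shows "\<bar>u \<bullet> v\<bar> \<le> euclid_norm u * euclid_norm v"
proof -
  have "\<bar>u \<bullet> v\<bar> \<le> (\<Sum>i<n. \<bar>u $ i\<bar> * \<bar>v $ i\<bar>)"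
    unfolding scalar_prod_def using assms
    by (auto simp: atLeast0LessThan abs_mult intro: order_trans[OF sum_abs])
  also have "\<dots> \<le> L2_set (\<lambda>i. u $ i) {..<n} * L2_set (\<lambda>i. v $ i) {..<n}"
    by (rule L2_set_mult_ineq)
  finally show ?thesis using assms by (simp add: euclid_norm_L2)
qed

lemma euclid_norm_mult_mat_vec_le:
  assumes "v \<in> carrier_vec (dim_col M)"
  shows "(euclid_norm (M *\<^sub>v v))\<^sup>2 \<le> (\<Sum>i<dim_row M. (euclid_norm (row M i))\<^sup>2) * (euclid_norm v)\<^sup>2"
proof -
  have "(euclid_norm (M *\<^sub>v v))\<^sup>2 = (\<Sum>i<dim_row M. (row M i \<bullet> v)\<^sup>2)"
    by (simp add: euclid_norm_sq_sum)
  also have "\<dots> \<le> (\<Sum>i<dim_row M. (euclid_norm (row M i))\<^sup>2 * (euclid_norm v)\<^sup>2)"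
  proof (rule sum_mono)
    fix i assume "i \<in> {..<dim_row M}"
    have "\<bar>row M i \<bullet> v\<bar> \<le> euclid_norm (row M i) * euclid_norm v"
      by (rule scalar_prod_le_euclid_norm[of _ "dim_col M"]) (use assms in auto)
    hence "\<bar>row M i \<bullet> v\<bar>\<^sup>2 \<le> (euclid_norm (row M i) * euclid_norm v)\<^sup>2"
      by (intro power_mono) auto
    thus "(row M i \<bullet> v)\<^sup>2 \<le> (euclid_norm (row M i))\<^sup>2 * (euclid_norm v)\<^sup>2"
      by (simp add: power_mult_distrib)
  qed
  finally show ?thesis by (simp add: sum_distrib_right)
qed

text \<open>Organised by rows because the rows of the controller error are the linear functionals
  whose variances add up to the excess risk.\<close>

definition frobenius_norm :: "real Matrix.mat \<Rightarrow> real" where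
  "frobenius_norm M = sqrt (\<Sum>i<dim_row M. (euclid_norm (row M i))\<^sup>2)"

lemma frobenius_norm_nonneg: "0 \<le> frobenius_norm M"
  by (simp add: frobenius_norm_def sum_nonneg)

lemma frobenius_norm_sq: "(frobenius_norm M)\<^sup>2 = (\<Sum>i<dim_row M. (euclid_norm (row M i))\<^sup>2)"
  by (simp add: frobenius_norm_def sum_nonneg)

lemma euclid_norm_mult_frobenius:
  assumes "v \<in> carrier_vec (dim_col M)"
  shows "euclid_norm (M *\<^sub>v v) \<le> frobenius_norm M * euclid_norm v"
proof (rule power2_le_imp_le)
  show "(euclid_norm (M *\<^sub>v v))\<^sup>2 \<le> (frobenius_norm M * euclid_norm v)\<^sup>2"
    unfolding power_mult_distrib frobenius_norm_sq by (rule euclid_norm_mult_mat_vec_le[OF assms])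
qed (simp add: frobenius_norm_nonneg)

text \<open>The real-valued \<open>SUP\<close> in \<open>spectral_norm\<close> carries information
  only for a bounded set; the Frobenius norm is an explicit bound.\<close>

lemma spectral_norm_bdd_above:
  "bdd_above ((\<lambda>x. euclid_norm (M *\<^sub>v x)) ` {x \<in> carrier_vec (dim_col M). euclid_norm x \<le> 1})"
proof (rule bdd_aboveI2)
  fix x assume x: "x \<in> {x \<in> carrier_vec (dim_col M). euclid_norm x \<le> 1}"
  have "euclid_norm (M *\<^sub>v x) \<le> frobenius_norm M * euclid_norm x"
    using x by (intro euclid_norm_mult_frobenius) auto
  also have "\<dots> \<le> frobenius_norm M"
    using x frobenius_norm_nonneg mult_left_le by auto
  finally show "euclid_norm (M *\<^sub>v x) \<le> frobenius_norm M" .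
qed

lemma spectral_norm_upper:
  "x \<in> carrier_vec (dim_col M) \<Longrightarrow> euclid_norm x \<le> 1 \<Longrightarrow> euclid_norm (M *\<^sub>v x) \<le> spectral_norm M"
  unfolding spectral_norm_def by (rule cSUP_upper2[OF spectral_norm_bdd_above]) auto

lemma spectral_norm_nonneg: "0 \<le> spectral_norm M"
  using spectral_norm_upper[of "0\<^sub>v (dim_col M)" M] by (simp add: order_trans[OF euclid_norm_nonneg])

lemma euclid_norm_mult_spectral:
  assumes M: "M \<in> carrier_mat m n" and x: "x \<in> carrier_vec n"
  shows "euclid_norm (M *\<^sub>v x) \<le> spectral_norm M * euclid_norm x"
proof (cases "euclid_norm x = 0")
  case True
  hence "x = 0\<^sub>v n" using x euclid_norm_eq_0 by blast
  hence "M *\<^sub>v x = 0\<^sub>v m" using M by auto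
  thus ?thesis by (simp add: True)
next
  case False
  define y where "y = (1 / euclid_norm x) \<cdot>\<^sub>v x"
  have pos: "0 < euclid_norm x" using False euclid_norm_nonneg[of x] by linarith
  have "euclid_norm (M *\<^sub>v y) \<le> spectral_norm M"
    by (rule spectral_norm_upper) (use M x pos in \<open>auto simp: y_def euclid_norm_smult\<close>)
  moreover have "M *\<^sub>v y = (1 / euclid_norm x) \<cdot>\<^sub>v (M *\<^sub>v x)"
    unfolding y_def using M x by (rule mult_mat_vec)
  ultimately show ?thesis using pos by (simp add: euclid_norm_smult field_simps)
qed

lemma spectral_norm_le_frobenius: "spectral_norm M \<le> frobenius_norm M"
  unfolding spectral_norm_def
proof (rule cSUP_least)
  show "{x \<in> carrier_vec (dim_col M). euclid_norm x \<le> 1} \<noteq> {}"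
    by (auto intro!: exI[of _ "0\<^sub>v (dim_col M)"])
  fix x assume x: "x \<in> {x \<in> carrier_vec (dim_col M). euclid_norm x \<le> 1}"
  have "euclid_norm (M *\<^sub>v x) \<le> frobenius_norm M * euclid_norm x"
    using x by (intro euclid_norm_mult_frobenius) auto
  also have "\<dots> \<le> frobenius_norm M"
    using x frobenius_norm_nonneg mult_left_le by auto
  finally show "euclid_norm (M *\<^sub>v x) \<le> frobenius_norm M" .
qed

text \<open>Growth bounds obtained from Jordan normal forms are entrywise. The factor
  \<open>sqrt (real (m * n))\<close> enters convergence arguments only.\<close>

lemma spectral_norm_le_entries:
  assumes M: "M \<in> carrier_mat m n" and "\<And>i j. i < m \<Longrightarrow> j < n \<Longrightarrow> \<bar>M $$ (i, j)\<bar> \<le> b" "0 \<le> b"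
  shows "spectral_norm M \<le> sqrt (real (m * n)) * b"
proof -
  have "(\<Sum>i<m. (euclid_norm (row M i))\<^sup>2) = (\<Sum>i<m. \<Sum>j<n. (M $$ (i, j))\<^sup>2)"
    using M by (auto simp: euclid_norm_sq_sum intro!: sum.cong)
  also have "\<dots> \<le> (\<Sum>i<m. \<Sum>j<n. b\<^sup>2)"
    using assms by (intro sum_mono) (auto simp: abs_le_square_iff[symmetric])
  finally have "frobenius_norm M \<le> sqrt (real (m * n) * b\<^sup>2)"
    using M unfolding frobenius_norm_def by (intro real_sqrt_le_mono) (auto simp: algebra_simps)
  also have "\<dots> = sqrt (real (m * n)) * b"
    using assms(3) by (simp add: real_sqrt_mult)
  finally show ?thesis using spectral_norm_le_frobenius[of M] by linarith
qed

subsection \<open>Decay of powers of stable matrices\<close>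

lemma smult_mat_mult_vec:
  fixes A :: "'a :: comm_ring_1 mat"
  assumes "A \<in> carrier_mat m n" "v \<in> carrier_vec n"
  shows "(c \<cdot>\<^sub>m A) *\<^sub>v v = c \<cdot>\<^sub>v (A *\<^sub>v v)"
proof (rule eq_vecI)
  fix i assume "i < dim_vec (c \<cdot>\<^sub>v (A *\<^sub>v v))"
  hence i: "i < m" using assms by auto
  have "row (c \<cdot>\<^sub>m A) i = c \<cdot>\<^sub>v row A i" using i assms by (intro eq_vecI) auto
  thus "((c \<cdot>\<^sub>m A) *\<^sub>v v) $ i = (c \<cdot>\<^sub>v (A *\<^sub>v v)) $ i" using i assms by simp
qed (use assms in auto)

lemma eigenvalue_smult_mat:
  fixes A :: "'a :: field mat"
  assumes A: "A \<in> carrier_mat n n" and c: "c \<noteq> 0" and ev: "eigenvalue (c \<cdot>\<^sub>m A) k"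
  shows "eigenvalue A (k / c)"
proof -
  obtain v where v: "v \<in> carrier_vec n" "v \<noteq> 0\<^sub>v n" "(c \<cdot>\<^sub>m A) *\<^sub>v v = k \<cdot>\<^sub>v v"
    using ev A unfolding eigenvalue_def eigenvector_def by auto
  have "c \<cdot>\<^sub>v (A *\<^sub>v v) = k \<cdot>\<^sub>v v"
    using v smult_mat_mult_vec[OF A] by metis
  hence "(1 / c) \<cdot>\<^sub>v (c \<cdot>\<^sub>v (A *\<^sub>v v)) = (1 / c) \<cdot>\<^sub>v (k \<cdot>\<^sub>v v)" by simp
  hence "A *\<^sub>v v = (k / c) \<cdot>\<^sub>v v"
    using c by (simp add: smult_smult_assoc)
  thus ?thesis using v A unfolding eigenvalue_def eigenvector_def by auto
qed

lemma pow_mat_smult: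
  fixes A :: "'a :: comm_semiring_1 mat"
  assumes A: "A \<in> carrier_mat n n"
  shows "(c \<cdot>\<^sub>m A) ^\<^sub>m t = c ^ t \<cdot>\<^sub>m (A ^\<^sub>m t)"
proof (induction t)
  case 0
  thus ?case using A by (intro eq_matI) auto
next
  case (Suc t)
  have At: "A ^\<^sub>m t \<in> carrier_mat n n" using A by (rule pow_carrier_mat)
  have "(c \<cdot>\<^sub>m A) ^\<^sub>m Suc t = (c ^ t \<cdot>\<^sub>m (A ^\<^sub>m t)) * (c \<cdot>\<^sub>m A)" using Suc by simp
  also have "\<dots> = c ^ t \<cdot>\<^sub>m (A ^\<^sub>m t * (c \<cdot>\<^sub>m A))"
    using A At by (intro mult_smult_assoc_mat) auto
  also have "A ^\<^sub>m t * (c \<cdot>\<^sub>m A) = c \<cdot>\<^sub>m (A ^\<^sub>m t * A)"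
    using A At by (intro mult_smult_distrib) auto
  finally show ?case using A At by (auto intro!: eq_matI simp: mult_ac)
qed

text \<open>An eigenvalue k of maximal modulus of the scaled matrix yields the eigenvalue k r of
  \<open>A\<close>, so |k| r is at most the spectral radius of \<open>A\<close>, which is below
  r.\<close>

lemma spectral_radius_smult_lt_1:
  assumes A: "A \<in> carrier_mat n n" and n: "0 < n" and r: "0 < r" "spectral_radius A < r"
  shows "spectral_radius (complex_of_real (1 / r) \<cdot>\<^sub>m A) < 1"
proof -
  let ?A = "complex_of_real (1 / r) \<cdot>\<^sub>m A"
  have "spectral_radius ?A \<in> norm ` spectrum ?A"
    by (rule spectral_radius_mem_max(1)[of _ n]) (use A n in auto)
  then obtain k where k: "eigenvalue ?A k" "spectral_radius ?A = norm k"
    by (auto simp: spectrum_def)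
  have "eigenvalue A (k / complex_of_real (1 / r))"
    by (rule eigenvalue_smult_mat[OF A _ k(1)]) (use r in auto)
  hence "norm (k / complex_of_real (1 / r)) \<le> spectral_radius A"
    by (intro spectral_radius_mem_max(2)[OF A n]) (auto simp: spectrum_def)
  also have "norm (k / complex_of_real (1 / r)) = norm k * r"
    using r by (simp add: norm_mult)
  finally have "norm k * r < 1 * r" using r by linarith
  hence "norm k < 1" using r by (simp only: mult_less_cancel_right_pos)
  thus ?thesis using k(2) by simp
qed

text \<open>Spectral radius below 1 gives bounded powers. Applied to M / r, with r strictly between
  the spectral radius and 1, boundedness becomes decay at the geometric rate r.\<close>

lemma pow_mat_exponential_decay:
  assumes M: "M \<in> carrier_mat n n" and n: "0 < n"
    and sr: "spectral_radius (map_mat complex_of_real M) < 1"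
  obtains b r where "0 \<le> b" "0 < r" "r < 1"
    "\<And>t i j. i < n \<Longrightarrow> j < n \<Longrightarrow> \<bar>(M ^\<^sub>m t) $$ (i, j)\<bar> \<le> b * r ^ t"
proof -
  let ?M = "map_mat complex_of_real M"
  have M': "?M \<in> carrier_mat n n" using M by simp
  \<comment> \<open>The midpoint between the spectral radius and 1; \<open>max 0\<close> gives
    \<open>0 < r\<close> without a separate proof that the spectral radius is nonnegative.\<close>
  define r where "r = (max 0 (spectral_radius ?M) + 1) / 2"
  have r: "0 < r" "r < 1" "spectral_radius ?M < r" using sr by (auto simp: r_def)
  let ?S = "complex_of_real (1 / r) \<cdot>\<^sub>m ?M"
  have S: "?S \<in> carrier_mat n n" using M' by simp
  obtain b where b: "\<And>t. norm_bound (?S ^\<^sub>m t) b"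
    using spectral_radius_jnf_norm_bound_less_1_upper_triangular[OF S
        spectral_radius_smult_lt_1[OF M' n r(1,3)]] by auto
  have entry: "\<bar>(M ^\<^sub>m t) $$ (i, j)\<bar> \<le> \<bar>b\<bar> * r ^ t" if ij: "i < n" "j < n" for t i j
  proof -
    have Mt: "M ^\<^sub>m t \<in> carrier_mat n n" using M by (rule pow_carrier_mat)
    have "norm ((?S ^\<^sub>m t) $$ (i, j)) \<le> b"
      using b[of t] ij pow_carrier_mat[OF S, of t] unfolding norm_bound_def
      by (metis carrier_matD)
    moreover have "(?S ^\<^sub>m t) $$ (i, j) = complex_of_real ((1 / r) ^ t * (M ^\<^sub>m t) $$ (i, j))"
      using ij carrier_matD[OF Mt]
      unfolding pow_mat_smult[OF M'] of_real_hom.mat_hom_pow[OF M, symmetric]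
      by (subst index_smult_mat) (simp_all del: index_map_mat(1) add: index_map_mat(1)[of i _ j])
    ultimately have "\<bar>(1 / r) ^ t * (M ^\<^sub>m t) $$ (i, j)\<bar> \<le> \<bar>b\<bar>"
      by (metis abs_ge_self norm_of_real order_trans)
    thus ?thesis using r by (simp add: abs_mult field_simps)
  qed
  show thesis by (rule that[of "\<bar>b\<bar>" r]) (use r entry in auto)
qed

lemma spectral_norm_pow_decay:
  assumes M: "M \<in> carrier_mat n n" and n: "0 < n"
    and sr: "spectral_radius (map_mat complex_of_real M) < 1"
  obtains b r where "0 \<le> b" "0 < r" "r < 1" "\<And>t. spectral_norm (M ^\<^sub>m t) \<le> b * r ^ t"
proof -
  obtain b r where br: "0 \<le> b" "0 < r" "r < 1"
    "\<And>t i j. i < n \<Longrightarrow> j < n \<Longrightarrow> \<bar>(M ^\<^sub>m t) $$ (i, j)\<bar> \<le> b * r ^ t"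
    using pow_mat_exponential_decay[OF assms] by blast
  have "spectral_norm (M ^\<^sub>m t) \<le> sqrt (real (n * n)) * (b * r ^ t)" for t
    by (rule spectral_norm_le_entries[OF pow_carrier_mat[OF M]]) (use br in auto)
  thus thesis using br by (intro that[of "sqrt (real (n * n)) * b" r]) (auto simp: mult.assoc)
qed

text \<open>Makes \<open>\<J>\<close> a genuine sum: on a divergent series \<open>suminf\<close> has
  no usable value.\<close>

lemma summable_spectral_norm_pow:
  assumes M: "M \<in> carrier_mat n n" and n: "0 < n"
    and sr: "spectral_radius (map_mat complex_of_real M) < 1"
  shows "summable (\<lambda>t. spectral_norm (M ^\<^sub>m t))"
proof -
  obtain b r where br: "0 \<le> b" "0 < r" "r < 1" "\<And>t. spectral_norm (M ^\<^sub>m t) \<le> b * r ^ t"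
    using spectral_norm_pow_decay[OF assms] by blast
  show ?thesis
  proof (rule summable_comparison_test')
    show "summable (\<lambda>t. b * r ^ t)" using br by (intro summable_mult summable_geometric) auto
    show "norm (spectral_norm (M ^\<^sub>m t)) \<le> b * r ^ t" if "0 \<le> t" for t
      using br(4)[of t] spectral_norm_nonneg[of "M ^\<^sub>m t"] by simp
  qed
qed

text \<open>Transposes appear because linear functionals are pulled back along the dynamics. The
  argument goes through the entries, whose bound is insensitive to transposition, and not through
  the spectral norm of \<open>M ^\<^sub>m t\<close>.\<close>

lemma pow_mat_mult_vec_tendsto_0:
  assumes M: "M \<in> carrier_mat n n" and n: "0 < n"
    and sr: "spectral_radius (map_mat complex_of_real M) < 1" and v: "v \<in> carrier_vec n"
  shows "(\<lambda>t. euclid_norm (transpose_mat (M ^\<^sub>m t) *\<^sub>v v)) \<longlonglongrightarrow> 0"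
proof -
  obtain b r where br: "0 \<le> b" "0 < r" "r < 1"
    "\<And>t i j. i < n \<Longrightarrow> j < n \<Longrightarrow> \<bar>(M ^\<^sub>m t) $$ (i, j)\<bar> \<le> b * r ^ t"
    using pow_mat_exponential_decay[OF M n sr] by blast
  have *: "euclid_norm (transpose_mat (M ^\<^sub>m t) *\<^sub>v v)
      \<le> (sqrt (real (n * n)) * b * euclid_norm v) * r ^ t" for t
  proof -
    have T: "transpose_mat (M ^\<^sub>m t) \<in> carrier_mat n n" using M by simp
    have "spectral_norm (transpose_mat (M ^\<^sub>m t)) \<le> sqrt (real (n * n)) * (b * r ^ t)"
    proof (rule spectral_norm_le_entries[OF T])
      show "\<bar>transpose_mat (M ^\<^sub>m t) $$ (i, j)\<bar> \<le> b * r ^ t" if "i < n" "j < n" for i j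
        using br(4)[OF that(2,1), of t] that carrier_matD[OF pow_carrier_mat[OF M, of t]]
        by (simp only: index_transpose_mat)
    qed (use br in simp)
    with euclid_norm_mult_spectral[OF T v]
    have "euclid_norm (transpose_mat (M ^\<^sub>m t) *\<^sub>v v) \<le> sqrt (real (n * n)) * (b * r ^ t) * euclid_norm v"
      by (meson euclid_norm_nonneg mult_right_mono order_trans)
    thus ?thesis by (simp only: mult_ac)
  qed
  have "(\<lambda>t. (sqrt (real (n * n)) * b * euclid_norm v) * r ^ t) \<longlonglongrightarrow> 0"
    using br by (intro tendsto_mult_right_zero LIMSEQ_power_zero) auto
  thus ?thesis
    by (rule tendsto_sandwich[OF _ always_eventually tendsto_const, rotated 2])
       (use * in \<open>auto simp only: euclid_norm_nonneg intro: always_eventually\<close>)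
qed

lemma J_nonneg:
  assumes "M \<in> carrier_mat n n" "0 < n" "spectral_radius (map_mat complex_of_real M) < 1"
  shows "0 \<le> \<J> M"
  unfolding \<J>_def by (intro suminf_nonneg summable_spectral_norm_pow[OF assms] spectral_norm_nonneg)

subsection \<open>Lyapunov equations and Rayleigh quotients\<close>

lemma scalar_prod_mult_mat_vec_le:
  assumes S: "S \<in> carrier_mat n n" and a: "a \<in> carrier_vec n" and b: "b \<in> carrier_vec n"
  shows "\<bar>a \<bullet> (S *\<^sub>v b)\<bar> \<le> euclid_norm a * (spectral_norm S * euclid_norm b)"
  using scalar_prod_le_euclid_norm[OF a mult_mat_vec_carrier[OF S b]]
    mult_left_mono[OF euclid_norm_mult_spectral[OF S b] euclid_norm_nonneg[of a]] by linarith

lemma scalar_prod_congruence: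
  fixes M :: "'a :: comm_ring_1 mat"
  assumes M: "M \<in> carrier_mat n m" and S: "S \<in> carrier_mat m m"
    and a: "a \<in> carrier_vec n" and b: "b \<in> carrier_vec n"
  shows "a \<bullet> ((M * S * transpose_mat M) *\<^sub>v b)
       = (transpose_mat M *\<^sub>v a) \<bullet> (S *\<^sub>v (transpose_mat M *\<^sub>v b))"
proof -
  have T: "transpose_mat M \<in> carrier_mat m n" using M by simp
  have Tb: "transpose_mat M *\<^sub>v b \<in> carrier_vec m" using T b by (rule mult_mat_vec_carrier)
  have "(M * S * transpose_mat M) *\<^sub>v b = M *\<^sub>v (S *\<^sub>v (transpose_mat M *\<^sub>v b))"
    using assoc_mult_mat_vec[OF mult_carrier_mat[OF M S] T b] assoc_mult_mat_vec[OF M S Tb] by simp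
  thus ?thesis using transpose_vec_mult_scalar[OF M _ a, of "S *\<^sub>v (transpose_mat M *\<^sub>v b)"]
      mult_mat_vec_carrier[OF S Tb] by simp
qed

text \<open>The Lyapunov equation tested against two vectors: advancing the state by one step is one
  application of \<open>transpose_mat M\<close> to the functional. The identity serves both to
  derive properties of \<open>S\<close> and to keep track of variances along the trajectory.\<close>

lemma lyapunov_step:
  fixes M :: "'a :: comm_ring_1 mat"
  assumes M: "M \<in> carrier_mat n n" and S: "S \<in> carrier_mat n n" and Q: "Q \<in> carrier_mat n n"
    and eq: "S = M * S * transpose_mat M + Q"
    and a: "a \<in> carrier_vec n" and b: "b \<in> carrier_vec n"
  shows "a \<bullet> (S *\<^sub>v b) = (transpose_mat M *\<^sub>v a) \<bullet> (S *\<^sub>v (transpose_mat M *\<^sub>v b)) + a \<bullet> (Q *\<^sub>v b)"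
proof -
  have T: "transpose_mat M \<in> carrier_mat n n" using M by simp
  have C: "M * S * transpose_mat M \<in> carrier_mat n n" using M S T by (meson mult_carrier_mat)
  have "S *\<^sub>v b = (M * S * transpose_mat M) *\<^sub>v b + Q *\<^sub>v b"
    using add_mult_distrib_mat_vec[OF C Q b] eq by simp
  hence "a \<bullet> (S *\<^sub>v b) = a \<bullet> ((M * S * transpose_mat M) *\<^sub>v b) + a \<bullet> (Q *\<^sub>v b)"
    using scalar_prod_add_distrib[OF a mult_mat_vec_carrier[OF C b] mult_mat_vec_carrier[OF Q b]] by simp
  thus ?thesis using scalar_prod_congruence[OF M S a b] by simp
qed

lemma symmetric_scalar_prod:
  fixes Q :: "'a :: comm_ring_1 mat"
  assumes Q: "Q \<in> carrier_mat n n" "transpose_mat Q = Q"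
    and a: "a \<in> carrier_vec n" and b: "b \<in> carrier_vec n"
  shows "a \<bullet> (Q *\<^sub>v b) = b \<bullet> (Q *\<^sub>v a)"
  using transpose_vec_mult_scalar[OF Q(1) b a] Q(2)
    comm_scalar_prod[OF mult_mat_vec_carrier[OF Q(1) a] b] by simp

context
  fixes M S Q :: "real Matrix.mat" and n :: nat
  assumes M: "M \<in> carrier_mat n n" and S: "S \<in> carrier_mat n n" and Q: "Q \<in> carrier_mat n n"
    and n: "0 < n" and sr: "spectral_radius (map_mat complex_of_real M) < 1"
    and eq: "S = M * S * transpose_mat M + Q"
begin

text \<open>The functional \<open>a\<close> pulled back t times. Following the form of
  \<open>S\<close> along such orbits replaces the series representation of the Lyapunov
  solution.\<close>

private definition orbit :: "real Matrix.vec \<Rightarrow> nat \<Rightarrow> real Matrix.vec" where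
  "orbit a t = transpose_mat (M ^\<^sub>m t) *\<^sub>v a"

private lemma orbit_carrier: "a \<in> carrier_vec n \<Longrightarrow> orbit a t \<in> carrier_vec n"
  using pow_carrier_mat[OF M, of t] unfolding orbit_def
  by (meson mult_mat_vec_carrier transpose_carrier_mat)

private lemma orbit_0: "a \<in> carrier_vec n \<Longrightarrow> orbit a 0 = a"
  using M by (simp add: orbit_def transpose_one)

private lemma orbit_Suc:
  assumes a: "a \<in> carrier_vec n"
  shows "orbit a (Suc t) = transpose_mat M *\<^sub>v orbit a t"
proof -
  have Mt: "M ^\<^sub>m t \<in> carrier_mat n n" using M by (rule pow_carrier_mat)
  have "transpose_mat (M ^\<^sub>m t * M) = transpose_mat M * transpose_mat (M ^\<^sub>m t)"
    using Mt M by (rule transpose_mult)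
  moreover have "(transpose_mat M * transpose_mat (M ^\<^sub>m t)) *\<^sub>v a
      = transpose_mat M *\<^sub>v (transpose_mat (M ^\<^sub>m t) *\<^sub>v a)"
    by (rule assoc_mult_mat_vec[of _ n n _ n]) (use Mt M a in auto)
  ultimately show ?thesis by (simp add: orbit_def)
qed

private lemma orbit_form_tendsto_0:
  assumes a: "a \<in> carrier_vec n" and b: "b \<in> carrier_vec n"
  shows "(\<lambda>t. orbit a t \<bullet> (S *\<^sub>v orbit b t)) \<longlonglongrightarrow> 0"
proof -
  have "(\<lambda>t. euclid_norm (orbit a t) * (spectral_norm S * euclid_norm (orbit b t))) \<longlonglongrightarrow> 0 * (spectral_norm S * 0)"
    unfolding orbit_def
    by (intro tendsto_mult tendsto_const pow_mat_mult_vec_tendsto_0[OF M n sr] a b)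
  hence "(\<lambda>t. euclid_norm (orbit a t) * (spectral_norm S * euclid_norm (orbit b t))) \<longlonglongrightarrow> 0" by simp
  thus ?thesis
  proof (rule Lim_null_comparison[rotated])
    show "\<forall>\<^sub>F t in sequentially. norm (orbit a t \<bullet> (S *\<^sub>v orbit b t))
        \<le> euclid_norm (orbit a t) * (spectral_norm S * euclid_norm (orbit b t))"
      using scalar_prod_mult_mat_vec_le[OF S orbit_carrier[OF a] orbit_carrier[OF b]] by simp
  qed
qed

text \<open>The antisymmetric part of the form of \<open>S\<close> satisfies the homogeneous
  equation, because \<open>Q\<close> is symmetric. It is therefore constant along orbits, and it
  tends to 0 by stability.\<close>

lemma lyapunov_symmetric:
  assumes Qsym: "transpose_mat Q = Q" and a: "a \<in> carrier_vec n" and b: "b \<in> carrier_vec n"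
  shows "a \<bullet> (S *\<^sub>v b) = b \<bullet> (S *\<^sub>v a)"
proof -
  define f where "f t = orbit a t \<bullet> (S *\<^sub>v orbit b t) - orbit b t \<bullet> (S *\<^sub>v orbit a t)" for t
  have "f (Suc t) = f t" for t
    unfolding f_def orbit_Suc[OF a] orbit_Suc[OF b]
    using lyapunov_step[OF M S Q eq orbit_carrier[OF a, of t] orbit_carrier[OF b, of t]]
      lyapunov_step[OF M S Q eq orbit_carrier[OF b, of t] orbit_carrier[OF a, of t]]
      symmetric_scalar_prod[OF Q Qsym orbit_carrier[OF a, of t] orbit_carrier[OF b, of t]]
    by linarith
  hence const: "f t = f 0" for t by (induction t) auto
  have "f \<longlonglongrightarrow> 0 - 0"
    unfolding f_def by (intro tendsto_diff orbit_form_tendsto_0 a b)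
  moreover have "f = (\<lambda>t. f 0)" by (rule ext) (rule const)
  ultimately have "(\<lambda>t. f 0) \<longlonglongrightarrow> 0" by simp
  hence "f 0 = 0" by (simp add: LIMSEQ_const_iff)
  thus ?thesis unfolding f_def orbit_0[OF a] orbit_0[OF b] by simp
qed

text \<open>Along an orbit the form of \<open>S\<close> drops by the form of \<open>Q\<close> in
  each step and tends to 0, so it can never have been negative.\<close>

lemma lyapunov_pos_def:
  assumes Qpos: "\<And>v. v \<in> carrier_vec n \<Longrightarrow> v \<noteq> 0\<^sub>v n \<Longrightarrow> 0 < v \<bullet> (Q *\<^sub>v v)"
    and a: "a \<in> carrier_vec n" and a0: "a \<noteq> 0\<^sub>v n"
  shows "0 < a \<bullet> (S *\<^sub>v a)"
proof -
  define g where "g t = orbit a t \<bullet> (S *\<^sub>v orbit a t)" for t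
  have step: "g t = g (Suc t) + orbit a t \<bullet> (Q *\<^sub>v orbit a t)" for t
    unfolding g_def orbit_Suc[OF a]
    by (rule lyapunov_step[OF M S Q eq orbit_carrier[OF a, of t] orbit_carrier[OF a, of t]])
  have Qnn: "0 \<le> v \<bullet> (Q *\<^sub>v v)" if v: "v \<in> carrier_vec n" for v
  proof (cases "v = 0\<^sub>v n")
    case True thus ?thesis using Q by simp
  next
    case False thus ?thesis using Qpos[OF v] by simp
  qed
  have "decseq g"
  proof (rule decseq_SucI)
    show "g (Suc t) \<le> g t" for t
      using step[of t] Qnn[OF orbit_carrier[OF a, of t]] by linarith
  qed
  moreover have "g \<longlonglongrightarrow> 0" unfolding g_def by (rule orbit_form_tendsto_0[OF a a])
  \<comment> \<open>Index 1 and not 0: the first drop, from \<open>g 0\<close> to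
    \<open>g 1\<close>, is what gives the strict inequality.\<close>
  ultimately have "0 \<le> g 1" by (rule decseq_ge)
  moreover have "g 0 = g 1 + a \<bullet> (Q *\<^sub>v a)" using step[of 0] by (simp add: orbit_0[OF a])
  ultimately have "0 < g 0" using Qpos[OF a a0] by linarith
  thus ?thesis by (simp add: g_def orbit_0[OF a])
qed

end

text \<open>Positivity is tested at w = c v - N v with c = \<open>spectral_norm N + 1\<close>.
  Expanding w \<bullet> N w leaves c |N v|^2 \<le> c^2 (v \<bullet> N v); the summand 1 keeps c
  positive, so that one factor c cancels. The point is that a vector on which the form is small is
  nearly in the kernel of \<open>N\<close>.\<close>

lemma psd_mult_vec_le:
  assumes N: "N \<in> carrier_mat n n"
    and sym: "\<And>a b. a \<in> carrier_vec n \<Longrightarrow> b \<in> carrier_vec n \<Longrightarrow> a \<bullet> (N *\<^sub>v b) = b \<bullet> (N *\<^sub>v a)"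
    and psd: "\<And>a. a \<in> carrier_vec n \<Longrightarrow> 0 \<le> a \<bullet> (N *\<^sub>v a)"
    and v: "v \<in> carrier_vec n"
  shows "(euclid_norm (N *\<^sub>v v))\<^sup>2 \<le> (spectral_norm N + 1) * (v \<bullet> (N *\<^sub>v v))"
proof -
  define c where "c = spectral_norm N + 1"
  have c: "0 < c" using spectral_norm_nonneg[of N] unfolding c_def by linarith
  define u where "u = N *\<^sub>v v"
  have u: "u \<in> carrier_vec n" unfolding u_def using N v by (rule mult_mat_vec_carrier)
  have Nu: "N *\<^sub>v u \<in> carrier_vec n" using N u by (rule mult_mat_vec_carrier)
  define w where "w = c \<cdot>\<^sub>v v - u"
  have w: "w \<in> carrier_vec n" unfolding w_def using u v by simp
  have "N *\<^sub>v w = c \<cdot>\<^sub>v u - N *\<^sub>v u"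
    unfolding w_def u_def using N v u
    by (subst mult_minus_distrib_mat_vec[of _ n n]) (auto simp: mult_mat_vec[of _ n n])
  hence "w \<bullet> (N *\<^sub>v w) = (c \<cdot>\<^sub>v v - u) \<bullet> (c \<cdot>\<^sub>v u - N *\<^sub>v u)" by (simp add: w_def)
  also have "\<dots> = (c * (c * (v \<bullet> u)) - c * (v \<bullet> (N *\<^sub>v u))) - (c * (u \<bullet> u) - u \<bullet> (N *\<^sub>v u))"
    using u v Nu
    by (subst minus_scalar_prod_distrib[of _ n], simp, simp, simp,
        subst scalar_prod_minus_distrib[of _ n], simp, simp, simp,
        subst scalar_prod_minus_distrib[of _ n], simp, simp, simp)
       (simp add: scalar_prod_smult_distrib algebra_simps)
  also have "v \<bullet> (N *\<^sub>v u) = u \<bullet> u" using sym[OF v u] by (simp add: u_def)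
  finally have "0 \<le> c * (c * (v \<bullet> u)) - 2 * (c * (u \<bullet> u)) + u \<bullet> (N *\<^sub>v u)"
    using psd[OF w] by simp
  moreover have "u \<bullet> (N *\<^sub>v u) \<le> spectral_norm N * (u \<bullet> u)"
  proof -
    have "euclid_norm u * (spectral_norm N * euclid_norm u) = spectral_norm N * (u \<bullet> u)"
      unfolding euclid_norm_sq[symmetric] by (simp add: power2_eq_square)
    thus ?thesis using scalar_prod_mult_mat_vec_le[OF N u u] by linarith
  qed
  moreover have "spectral_norm N * (u \<bullet> u) \<le> c * (u \<bullet> u)"
    by (intro mult_right_mono) (auto simp: c_def simp flip: euclid_norm_sq)
  ultimately have "c * (u \<bullet> u) \<le> c * (c * (v \<bullet> u))" by linarith
  hence "u \<bullet> u \<le> c * (v \<bullet> u)" using c by (simp only: mult_le_cancel_left_pos)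
  thus ?thesis by (simp only: euclid_norm_sq u_def c_def)
qed

text \<open>\<mu> is the infimum of the form on the unit sphere, and no compactness is invoked to
  show that it is attained. If S - \<mu> I were invertible, \<open>psd_mult_vec_le\<close> would
  keep its form above a fixed positive number on the whole sphere, contradicting the choice of
  \<mu>.\<close>

lemma exists_eigenvalue_le_rayleigh:
  fixes S :: "real Matrix.mat"
  assumes S: "S \<in> carrier_mat n n" and n: "0 < n"
    and sym: "\<And>a b. a \<in> carrier_vec n \<Longrightarrow> b \<in> carrier_vec n \<Longrightarrow> a \<bullet> (S *\<^sub>v b) = b \<bullet> (S *\<^sub>v a)"
  obtains \<mu> where "eigenvalue S \<mu>" "\<And>v. v \<in> carrier_vec n \<Longrightarrow> \<mu> * (v \<bullet> v) \<le> v \<bullet> (S *\<^sub>v v)"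
proof -
  define U where "U = {v \<in> carrier_vec n. euclid_norm v = 1}"
  define \<mu> where "\<mu> = (INF v\<in>U. v \<bullet> (S *\<^sub>v v))"
  have "unit_vec n 0 \<in> U"
    using n by (simp add: U_def euclid_norm_def)
  hence U_ne: "U \<noteq> {}" by auto
  have bdd: "bdd_below ((\<lambda>v. v \<bullet> (S *\<^sub>v v)) ` U)"
  proof (rule bdd_belowI2)
    fix v assume "v \<in> U"
    thus "- spectral_norm S \<le> v \<bullet> (S *\<^sub>v v)"
      using scalar_prod_mult_mat_vec_le[OF S, of v v] by (auto simp: U_def)
  qed
  have ray: "\<mu> * (v \<bullet> v) \<le> v \<bullet> (S *\<^sub>v v)" if v: "v \<in> carrier_vec n" for v
  proof (cases "v = 0\<^sub>v n")
    case True thus ?thesis using S by simp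
  next
    case False
    hence pos: "0 < euclid_norm v" using euclid_norm_eq_0[OF v] euclid_norm_nonneg[of v] by linarith
    define u where "u = (1 / euclid_norm v) \<cdot>\<^sub>v v"
    have u: "u \<in> U" using v pos by (simp add: U_def u_def euclid_norm_smult)
    have "\<mu> \<le> u \<bullet> (S *\<^sub>v u)" unfolding \<mu>_def by (rule cINF_lower[OF bdd u])
    also have "\<dots> = (v \<bullet> (S *\<^sub>v v)) / (euclid_norm v)\<^sup>2"
      unfolding u_def using v S by (simp add: mult_mat_vec[OF S v] power2_eq_square)
    finally have "\<mu> * (euclid_norm v)\<^sup>2 \<le> v \<bullet> (S *\<^sub>v v)" using pos by (simp add: field_simps)
    thus ?thesis by (simp only: euclid_norm_sq)
  qed
  define N where "N = S - \<mu> \<cdot>\<^sub>m 1\<^sub>m n"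
  have N: "N \<in> carrier_mat n n" unfolding N_def by (rule minus_carrier_mat) simp
  have Nv: "N *\<^sub>v v = S *\<^sub>v v - \<mu> \<cdot>\<^sub>v v" if v: "v \<in> carrier_vec n" for v
    unfolding N_def using S v
    by (subst minus_mult_distrib_mat_vec[of _ n n]) (auto simp: smult_mat_mult_vec[of _ n n])
  have form: "a \<bullet> (N *\<^sub>v b) = a \<bullet> (S *\<^sub>v b) - \<mu> * (a \<bullet> b)"
    if "a \<in> carrier_vec n" "b \<in> carrier_vec n" for a b
    using that S by (simp add: Nv scalar_prod_minus_distrib[of _ n])
  have "det N = 0"
  proof (rule ccontr)
    assume "det N \<noteq> 0"
    then obtain R where R: "R \<in> carrier_mat n n" "R * N = 1\<^sub>m n"
      using det_non_zero_imp_unit[OF N, of "()"] by (auto simp: Units_def ring_mat_simps)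
    \<comment> \<open>For a unit vector v, 1 = |R N v| \<le> \<open>spectral_norm R\<close> |N v|;
      squaring and bounding |N v|^2 by \<open>psd_mult_vec_le\<close> produces this
      constant.\<close>
    let ?k = "(spectral_norm R)\<^sup>2 * (spectral_norm N + 1)"
    have *: "1 \<le> ?k * (v \<bullet> (S *\<^sub>v v) - \<mu>)" if "v \<in> U" for v
    proof -
      have v: "v \<in> carrier_vec n" "euclid_norm v = 1" using that by (auto simp: U_def)
      have "R *\<^sub>v (N *\<^sub>v v) = v" using R N v assoc_mult_mat_vec[OF R(1) N v(1)] by simp
      hence "1 \<le> spectral_norm R * euclid_norm (N *\<^sub>v v)"
        using euclid_norm_mult_spectral[OF R(1) mult_mat_vec_carrier[OF N v(1)]] v by simp
      hence "1 \<le> (spectral_norm R * euclid_norm (N *\<^sub>v v))\<^sup>2" by (rule one_le_power)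
      also have "\<dots> = (spectral_norm R)\<^sup>2 * (euclid_norm (N *\<^sub>v v))\<^sup>2" by (rule power_mult_distrib)
      also have "\<dots> \<le> (spectral_norm R)\<^sup>2 * ((spectral_norm N + 1) * (v \<bullet> (N *\<^sub>v v)))"
      proof (intro mult_left_mono psd_mult_vec_le[OF N _ _ v(1)])
        show "a \<bullet> (N *\<^sub>v b) = b \<bullet> (N *\<^sub>v a)" if "a \<in> carrier_vec n" "b \<in> carrier_vec n" for a b
          using that sym[OF that] comm_scalar_prod[OF that] by (simp add: form)
        show "0 \<le> a \<bullet> (N *\<^sub>v a)" if "a \<in> carrier_vec n" for a
          using ray[OF that] form[OF that that] by simp
      qed simp
      also have "v \<bullet> (N *\<^sub>v v) = v \<bullet> (S *\<^sub>v v) - \<mu>"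
        using form[OF v(1) v(1)] v(2) euclid_norm_sq[of v] by simp
      finally show ?thesis by (simp only: mult.assoc)
    qed
    have k: "0 < ?k"
    proof -
      obtain v where "v \<in> U" using U_ne by auto
      from *[OF this] have "?k \<noteq> 0" by auto
      moreover have "0 \<le> ?k" using spectral_norm_nonneg[of N] by simp
      ultimately show ?thesis by linarith
    qed
    have "\<mu> + 1 / ?k \<le> \<mu>"
    proof -
      have "\<mu> + 1 / ?k \<le> (INF v\<in>U. v \<bullet> (S *\<^sub>v v))"
      proof (rule cINF_greatest[OF U_ne])
        fix v assume "v \<in> U"
        from *[OF this] have "1 / ?k \<le> v \<bullet> (S *\<^sub>v v) - \<mu>"
          using k by (subst pos_divide_le_eq) (simp_all only: mult.commute)
        thus "\<mu> + 1 / ?k \<le> v \<bullet> (S *\<^sub>v v)" by linarith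
      qed
      thus ?thesis by (simp only: \<mu>_def[symmetric])
    qed
    thus False using k by simp
  qed
  then obtain v where v: "v \<in> carrier_vec n" "v \<noteq> 0\<^sub>v n" "N *\<^sub>v v = 0\<^sub>v n"
    using det_0_iff_vec_prod_zero[OF N] by auto
  have "S *\<^sub>v v = \<mu> \<cdot>\<^sub>v v"
  proof (rule eq_vecI)
    fix i assume "i < dim_vec (\<mu> \<cdot>\<^sub>v v)"
    hence i: "i < n" using v by simp
    have "(S *\<^sub>v v - \<mu> \<cdot>\<^sub>v v) $ i = 0" using v i Nv[OF v(1)] by simp
    thus "(S *\<^sub>v v) $ i = (\<mu> \<cdot>\<^sub>v v) $ i" using i v S by simp
  qed (use S v in auto)
  hence "eigenvalue S \<mu>" using v S by (auto simp: eigenvalue_def eigenvector_def)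
  thus thesis using ray that by blast
qed

text \<open>\<open>Min (spectrum S)\<close> is meaningful because the spectrum is finite and
  contains the eigenvalue \<mu> just constructed; being the minimum, it lies below \<mu>, hence
  below every Rayleigh quotient. For positivity the form is evaluated at an eigenvector of the
  minimum.\<close>

lemma
  assumes S: "S \<in> carrier_mat n n" and n: "0 < n"
    and sym: "\<And>a b. a \<in> carrier_vec n \<Longrightarrow> b \<in> carrier_vec n \<Longrightarrow> a \<bullet> (S *\<^sub>v b) = b \<bullet> (S *\<^sub>v a)"
  shows lambda_min_le_rayleigh: "v \<in> carrier_vec n \<Longrightarrow> lambda_min S * (v \<bullet> v) \<le> v \<bullet> (S *\<^sub>v v)"
    and lambda_min_pos: "(\<And>v. v \<in> carrier_vec n \<Longrightarrow> v \<noteq> 0\<^sub>v n \<Longrightarrow> 0 < v \<bullet> (S *\<^sub>v v)) \<Longrightarrow> 0 < lambda_min S"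
proof -
  obtain \<mu> where \<mu>: "eigenvalue S \<mu>" "\<And>v. v \<in> carrier_vec n \<Longrightarrow> \<mu> * (v \<bullet> v) \<le> v \<bullet> (S *\<^sub>v v)"
    using exists_eigenvalue_le_rayleigh[OF assms] by blast
  have mem: "\<mu> \<in> spectrum S" using \<mu>(1) by (simp add: spectrum_def)
  have fin: "finite (spectrum S)" by (rule card_finite_spectrum(1)[OF S])
  show "lambda_min S * (v \<bullet> v) \<le> v \<bullet> (S *\<^sub>v v)" if v: "v \<in> carrier_vec n"
  proof -
    have "lambda_min S \<le> \<mu>" unfolding lambda_min_def by (rule Min_le[OF fin mem])
    hence "lambda_min S * (v \<bullet> v) \<le> \<mu> * (v \<bullet> v)"
      by (intro mult_right_mono) (auto simp flip: euclid_norm_sq)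
    thus ?thesis using \<mu>(2)[OF v] by linarith
  qed
  show "0 < lambda_min S" if pos: "\<And>v. v \<in> carrier_vec n \<Longrightarrow> v \<noteq> 0\<^sub>v n \<Longrightarrow> 0 < v \<bullet> (S *\<^sub>v v)"
  proof -
    have "lambda_min S \<in> spectrum S" unfolding lambda_min_def using fin mem by (intro Min_in) auto
    then obtain v where v: "v \<in> carrier_vec n" "v \<noteq> 0\<^sub>v n" "S *\<^sub>v v = lambda_min S \<cdot>\<^sub>v v"
      using S by (auto simp: spectrum_def eigenvalue_def eigenvector_def)
    have "0 < lambda_min S * (v \<bullet> v)" using pos[OF v(1,2)] v(1,3) by simp
    moreover have "0 \<le> v \<bullet> v" by (simp flip: euclid_norm_sq)
    ultimately show ?thesis by (simp add: zero_less_mult_iff)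
  qed
qed

section \<open>The covariance of the combined process noise\<close>

lemma gram_add_form:
  fixes B W :: "real Matrix.mat"
  assumes B: "B \<in> carrier_mat n m" and W: "W \<in> carrier_mat n n" and v: "v \<in> carrier_vec n"
  shows "v \<bullet> ((c \<cdot>\<^sub>m (B * transpose_mat B) + W) *\<^sub>v v)
       = c * ((transpose_mat B *\<^sub>v v) \<bullet> (transpose_mat B *\<^sub>v v)) + v \<bullet> (W *\<^sub>v v)"
proof -
  let ?b = "transpose_mat B *\<^sub>v v"
  have Bt: "transpose_mat B \<in> carrier_mat m n" using B by simp
  have b: "?b \<in> carrier_vec m" using Bt v by (rule mult_mat_vec_carrier)
  have BB: "B * transpose_mat B \<in> carrier_mat n n" using B by simp
  hence cBB: "c \<cdot>\<^sub>m (B * transpose_mat B) \<in> carrier_mat n n" by simp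
  have "(c \<cdot>\<^sub>m (B * transpose_mat B) + W) *\<^sub>v v = c \<cdot>\<^sub>v (B *\<^sub>v ?b) + W *\<^sub>v v"
    unfolding add_mult_distrib_mat_vec[OF cBB W v] smult_mat_mult_vec[OF BB v]
      assoc_mult_mat_vec[OF B Bt v] ..
  also have "v \<bullet> \<dots> = c * (?b \<bullet> ?b) + v \<bullet> (W *\<^sub>v v)"
    using mult_mat_vec_carrier[OF B b] mult_mat_vec_carrier[OF W v] v
      transpose_vec_mult_scalar[OF B b v]
    by (subst scalar_prod_add_distrib[of _ n]) auto
  finally show ?thesis .
qed

lemma gram_add_symmetric:
  fixes B W :: "real Matrix.mat"
  assumes B: "B \<in> carrier_mat n m" and W: "W \<in> carrier_mat n n" "transpose_mat W = W"
  shows "transpose_mat (c \<cdot>\<^sub>m (B * transpose_mat B) + W) = c \<cdot>\<^sub>m (B * transpose_mat B) + W"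
proof -
  have Bt: "transpose_mat B \<in> carrier_mat m n" using B by simp
  have cBB: "c \<cdot>\<^sub>m (B * transpose_mat B) \<in> carrier_mat n n" using B by simp
  have "transpose_mat (c \<cdot>\<^sub>m (B * transpose_mat B)) = c \<cdot>\<^sub>m transpose_mat (B * transpose_mat B)"
    by (intro eq_matI) auto
  also have "transpose_mat (B * transpose_mat B) = B * transpose_mat B"
    using transpose_mult[OF B Bt] by simp
  finally show ?thesis using transpose_add[OF cBB W(1)] W(2) by simp
qed

subsection \<open>Centered normal random variables\<close>

text \<open>The law N(0,s), with s the variance, described by its characteristic function. Unlike a
  density, this covers the degenerate case s = 0, which arises whenever a functional is pulled back
  to the zero vector, and it turns sums of independent variables into products.\<close>

definition normal_rv :: "'a measure \<Rightarrow> ('a \<Rightarrow> real) \<Rightarrow> real \<Rightarrow> bool" where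
  "normal_rv M X s \<longleftrightarrow> prob_space M \<and> X \<in> borel_measurable M \<and>
     (\<forall>t. (CLINT x|M. iexp (t * X x)) = complex_of_real (exp (- (s * t\<^sup>2) / 2)))"

lemma normal_rv_zero: "prob_space M \<Longrightarrow> normal_rv M (\<lambda>_. 0) 0"
  by (simp add: normal_rv_def prob_space.prob_space)

lemma normal_rv_cong:
  assumes "\<And>x. x \<in> space M \<Longrightarrow> X x = Y x"
  shows "normal_rv M X s \<longleftrightarrow> normal_rv M Y s"
proof -
  have "X \<in> borel_measurable M \<longleftrightarrow> Y \<in> borel_measurable M"
    using assms by (rule measurable_cong)
  moreover have "(CLINT x|M. iexp (t * X x)) = (CLINT x|M. iexp (t * Y x))" for t
    using assms by (intro Bochner_Integration.integral_cong) auto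
  ultimately show ?thesis by (simp add: normal_rv_def)
qed

lemma distributed_normal_rv:
  assumes M: "prob_space M" and X: "distributed M lborel X (normal_density 0 \<sigma>)" and s: "0 < \<sigma>"
  shows "normal_rv M X (\<sigma>\<^sup>2)"
proof -
  interpret prob_space M by fact
  have mX: "X \<in> borel_measurable M" using distributed_measurable[OF X] by simp
  have "distributed M lborel (\<lambda>x. X x / \<sigma>) std_normal_density"
    using X normal_standard_normal_convert[OF s, of X 0] by simp
  hence std: "distr M lborel (\<lambda>x. X x / \<sigma>) = std_normal_distribution"
    by (rule distributed_distr_eq_density)
  have "(CLINT x|M. iexp (t * X x)) = complex_of_real (exp (- (\<sigma>\<^sup>2 * t\<^sup>2) / 2))" for t
  proof -
    have "(CLINT x|M. iexp (t * X x)) = (CLINT x|M. iexp ((t * \<sigma>) * (X x / \<sigma>)))"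
      using s by (intro Bochner_Integration.integral_cong) auto
    also have "\<dots> = (CLINT y|distr M lborel (\<lambda>x. X x / \<sigma>). iexp ((t * \<sigma>) * y))"
      by (rule integral_distr[symmetric]) (use mX in auto)
    also have "\<dots> = char std_normal_distribution (t * \<sigma>)"
      unfolding std char_def ..
    also have "\<dots> = complex_of_real (exp (- (\<sigma>\<^sup>2 * t\<^sup>2) / 2))"
      by (simp add: char_std_normal_distribution power_mult_distrib mult.commute)
    finally show ?thesis .
  qed
  thus ?thesis using mX M by (simp add: normal_rv_def)
qed

text \<open>The way back from characteristic functions to densities, by uniqueness; the moment
  computations are done with densities, hence for positive variance.\<close>

lemma normal_rv_distr:
  assumes X: "normal_rv M X s" and s: "0 < s"
  shows "distr M borel X = density lborel (normal_density 0 (sqrt s))"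
proof (rule Levy_uniqueness)
  let ?N = "density lborel (normal_density 0 (sqrt s))"
  have M: "prob_space M" and mX: "X \<in> borel_measurable M" using X by (auto simp: normal_rv_def)
  show "real_distribution (distr M borel X)"
    using prob_space.prob_space_distr[OF M mX]
    by (auto simp: real_distribution_def real_distribution_axioms_def)
  have N: "prob_space ?N" using s by (intro prob_space_normal_density) simp
  thus "real_distribution ?N"
    by (auto simp: real_distribution_def real_distribution_axioms_def)
  have "normal_rv ?N (\<lambda>x. x) ((sqrt s)\<^sup>2)"
  proof (rule distributed_normal_rv[OF N])
    show "distributed ?N lborel (\<lambda>x. x) (normal_density 0 (sqrt s))"
      unfolding distributed_def by (auto intro!: measure_eqI simp: emeasure_distr)
  qed (use s in simp)
  thus "char (distr M borel X) = char ?N"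
    using X mX s by (auto simp: normal_rv_def char_def integral_distr)
qed

section \<open>Sums of independent normal variables\<close>

lemma prob_space_integrable_iexp:
  assumes "prob_space M" "f \<in> borel_measurable M"
  shows "integrable M (\<lambda>x. iexp (f x))"
  using assms by (intro prob_space.integrable_iexp) auto

lemma normal_rv_pair:
  assumes f: "normal_rv M1 f s" and g: "normal_rv M2 g r"
  shows "normal_rv (M1 \<Otimes>\<^sub>M M2) (\<lambda>\<omega>. f (fst \<omega>) + g (snd \<omega>)) (s + r)"
proof -
  have M1: "prob_space M1" and M2: "prob_space M2"
    and [measurable]: "f \<in> borel_measurable M1" "g \<in> borel_measurable M2"
    using f g by (auto simp: normal_rv_def)
  interpret M1: prob_space M1 by fact
  interpret M2: prob_space M2 by fact
  interpret P: pair_prob_space M1 M2 ..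
  have meas: "(\<lambda>\<omega>. f (fst \<omega>) + g (snd \<omega>)) \<in> borel_measurable (M1 \<Otimes>\<^sub>M M2)" by measurable
  have "(CLINT \<omega>|M1 \<Otimes>\<^sub>M M2. iexp (t * (f (fst \<omega>) + g (snd \<omega>))))
      = complex_of_real (exp (- ((s + r) * t\<^sup>2) / 2))" for t
  proof -
    have "(CLINT \<omega>|M1 \<Otimes>\<^sub>M M2. iexp (t * (f (fst \<omega>) + g (snd \<omega>))))
        = (CLINT x|M1. CLINT y|M2. iexp (t * (f x + g y)))"
      using P.integral_fst'[OF prob_space_integrable_iexp[OF P.prob_space_axioms,
          of "\<lambda>\<omega>. t * (f (fst \<omega>) + g (snd \<omega>))"]]
      by simp
    also have "\<dots> = (CLINT x|M1. CLINT y|M2. iexp (t * f x) * iexp (t * g y))"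
      by (simp add: distrib_left exp_add)
    also have "\<dots> = (CLINT x|M1. iexp (t * f x)) * (CLINT y|M2. iexp (t * g y))"
      by simp
    also have "\<dots> = complex_of_real (exp (- (s * t\<^sup>2) / 2)) * complex_of_real (exp (- (r * t\<^sup>2) / 2))"
      using f g unfolding normal_rv_def by presburger
    also have "\<dots> = complex_of_real (exp (- (s * t\<^sup>2) / 2 + - (r * t\<^sup>2) / 2))"
      by (simp only: exp_add of_real_mult)
    also have "- (s * t\<^sup>2) / 2 + - (r * t\<^sup>2) / 2 = - ((s + r) * t\<^sup>2) / 2"
      by (simp add: field_simps)
    finally show ?thesis .
  qed
  thus ?thesis using meas P.prob_space_axioms by (simp add: normal_rv_def)
qed

lemma normal_rv_PiM:
  assumes I: "finite I" and M: "prob_space M" and f: "\<And>i. i \<in> I \<Longrightarrow> normal_rv M (f i) (s i)"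
  shows "normal_rv (\<Pi>\<^sub>M i\<in>I. M) (\<lambda>\<omega>. \<Sum>i\<in>I. f i (\<omega> i)) (\<Sum>i\<in>I. s i)"
proof -
  interpret M: prob_space M by fact
  interpret P: product_prob_space "\<lambda>_. M" I ..
  have [measurable]: "f i \<in> borel_measurable M" if "i \<in> I" for i
    using f[OF that] by (simp add: normal_rv_def)
  have meas: "(\<lambda>\<omega>. \<Sum>i\<in>I. f i (\<omega> i)) \<in> borel_measurable (\<Pi>\<^sub>M i\<in>I. M)" by measurable
  have "(CLINT \<omega>|(\<Pi>\<^sub>M i\<in>I. M). iexp (t * (\<Sum>i\<in>I. f i (\<omega> i))))
      = complex_of_real (exp (- ((\<Sum>i\<in>I. s i) * t\<^sup>2) / 2))" for t
  proof -
    have "(CLINT \<omega>|(\<Pi>\<^sub>M i\<in>I. M). iexp (t * (\<Sum>i\<in>I. f i (\<omega> i))))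
        = (CLINT \<omega>|(\<Pi>\<^sub>M i\<in>I. M). (\<Prod>i\<in>I. iexp (t * f i (\<omega> i))))"
      by (simp add: exp_sum[OF I, symmetric] sum_distrib_left)
    also have "\<dots> = (\<Prod>i\<in>I. CLINT x|M. iexp (t * f i x))"
      by (rule P.product_integral_prod[OF I], rule prob_space_integrable_iexp[OF M]) simp
    also have "\<dots> = (\<Prod>i\<in>I. complex_of_real (exp (- (s i * t\<^sup>2) / 2)))"
      using f by (intro prod.cong refl) (simp add: normal_rv_def)
    also have "\<dots> = complex_of_real (exp (\<Sum>i\<in>I. - (s i * t\<^sup>2) / 2))"
      by (simp add: exp_sum[OF I])
    also have "(\<Sum>i\<in>I. - (s i * t\<^sup>2) / 2) = - ((\<Sum>i\<in>I. s i) * t\<^sup>2) / 2"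
      by (simp add: sum_distrib_right sum_negf sum_divide_distrib)
    finally show ?thesis .
  qed
  thus ?thesis using meas P.prob_space_axioms by (simp add: normal_rv_def)
qed

text \<open>The state at time t depends on the noise before t only, while the noise space is a
  product over all of \<open>{..<T}\<close>. The missing indices are filled with zero functionals,
  normal of variance 0.\<close>

lemma normal_rv_PiM_subset:
  assumes I: "finite I" "J \<subseteq> I" and M: "prob_space M" and f: "\<And>i. i \<in> J \<Longrightarrow> normal_rv M (f i) (s i)"
  shows "normal_rv (\<Pi>\<^sub>M i\<in>I. M) (\<lambda>\<omega>. \<Sum>i\<in>J. f i (\<omega> i)) (\<Sum>i\<in>J. s i)"
proof -
  let ?f = "\<lambda>i. if i \<in> J then f i else (\<lambda>_. 0)" and ?s = "\<lambda>i. if i \<in> J then s i else 0"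
  have "normal_rv (\<Pi>\<^sub>M i\<in>I. M) (\<lambda>\<omega>. \<Sum>i\<in>I. ?f i (\<omega> i)) (\<Sum>i\<in>I. ?s i)"
    using I(1) M f by (intro normal_rv_PiM) (auto intro: normal_rv_zero)
  moreover have "(\<Sum>i\<in>I. ?f i (\<omega> i)) = (\<Sum>i\<in>J. f i (\<omega> i))" for \<omega>
    using I by (intro sum.mono_neutral_cong_right) auto
  moreover have "(\<Sum>i\<in>I. ?s i) = (\<Sum>i\<in>J. s i)"
    using I by (intro sum.mono_neutral_cong_right) auto
  ultimately show ?thesis by simp
qed

section \<open>Quadratic and exponential moments\<close>

lemma normal_rv_second_moment:
  assumes X: "normal_rv M X s" and s: "0 < s"
  shows "has_bochner_integral M (\<lambda>x. (X x)\<^sup>2) s"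
proof -
  have mX: "X \<in> borel_measurable M" using X by (simp add: normal_rv_def)
  have "has_bochner_integral lborel (\<lambda>x. normal_density 0 (sqrt s) x *\<^sub>R x\<^sup>2) s"
    using normal_moment_even[of "sqrt s" 0 1] s by simp
  hence "has_bochner_integral (density lborel (normal_density 0 (sqrt s))) (\<lambda>x. x\<^sup>2) s"
    by (intro has_bochner_integral_density) auto
  hence "has_bochner_integral (distr M borel X) (\<lambda>x. x\<^sup>2) s"
    by (simp only: normal_rv_distr[OF X s])
  thus ?thesis using mX by (simp add: has_bochner_integral_iff integrable_distr_eq integral_distr)
qed

text \<open>The rate 1 / (4 s) is half the critical rate 1 / (2 s): multiplying by this exponential
  turns the density of variance s into \<open>sqrt 2\<close> times the density of variance 2 s,
  which integrates to 1.\<close>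

lemma normal_rv_exp_square:
  assumes X: "normal_rv M X s" and s: "0 < s"
  shows "has_bochner_integral M (\<lambda>x. exp ((X x)\<^sup>2 / (4 * s))) (sqrt 2)"
proof -
  have mX: "X \<in> borel_measurable M" using X by (simp add: normal_rv_def)
  have eq: "normal_density 0 (sqrt s) x *\<^sub>R exp (x\<^sup>2 / (4 * s)) = sqrt 2 * normal_density 0 (sqrt (2 * s)) x" for x
  proof -
    have "- (x\<^sup>2 / (2 * s)) + x\<^sup>2 / (4 * s) = - (x\<^sup>2 / (4 * s))" using s by (simp add: field_simps)
    hence "exp (- (x\<^sup>2 / (2 * s))) * exp (x\<^sup>2 / (4 * s)) = exp (- (x\<^sup>2 / (4 * s)))"
      by (metis exp_add)
    moreover have "normal_density 0 (sqrt s) x = 1 / sqrt (2 * pi * s) * exp (- (x\<^sup>2 / (2 * s)))"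
      using s by (simp add: normal_density_def)
    moreover have "sqrt (2 * pi * (2 * s)) = sqrt 2 * sqrt (2 * pi * s)"
      by (simp flip: real_sqrt_mult add: mult_ac)
    hence "normal_density 0 (sqrt (2 * s)) x = 1 / (sqrt 2 * sqrt (2 * pi * s)) * exp (- (x\<^sup>2 / (4 * s)))"
      using s by (simp add: normal_density_def del: real_sqrt_mult)
    ultimately show ?thesis by (simp del: real_sqrt_mult)
  qed
  have "has_bochner_integral lborel (\<lambda>x. sqrt 2 * normal_density 0 (sqrt (2 * s)) x) (sqrt 2 * 1)"
    using s by (intro has_bochner_integral_mult_right) (auto simp: has_bochner_integral_iff)
  hence "has_bochner_integral lborel (\<lambda>x. normal_density 0 (sqrt s) x *\<^sub>R exp (x\<^sup>2 / (4 * s))) (sqrt 2)"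
    unfolding eq by simp
  hence "has_bochner_integral (density lborel (normal_density 0 (sqrt s))) (\<lambda>x. exp (x\<^sup>2 / (4 * s))) (sqrt 2)"
    by (intro has_bochner_integral_density) auto
  hence "has_bochner_integral (distr M borel X) (\<lambda>x. exp (x\<^sup>2 / (4 * s))) (sqrt 2)"
    by (simp only: normal_rv_distr[OF X s])
  thus ?thesis using mX by (simp add: has_bochner_integral_iff integrable_distr_eq integral_distr)
qed

text \<open>Convexity of \<open>exp\<close> replaces independence of the coordinates.\<close>

lemma normal_rv_exp_sum_squares:
  assumes I: "finite I" "I \<noteq> {}" and X: "\<And>i. i \<in> I \<Longrightarrow> normal_rv M (X i) (s i)"
    and s: "\<And>i. i \<in> I \<Longrightarrow> 0 < s i" and \<tau>: "\<tau> = (\<Sum>i\<in>I. s i)"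
  shows "integrable M (\<lambda>x. exp ((\<Sum>i\<in>I. (X i x)\<^sup>2) / (4 * \<tau>)))" (is "integrable M ?f")
    and "(\<integral>x. exp ((\<Sum>i\<in>I. (X i x)\<^sup>2) / (4 * \<tau>)) \<partial>M) \<le> sqrt 2"
proof -
  have \<tau>pos: "0 < \<tau>" unfolding \<tau> using I s by (rule sum_pos)
  have [measurable]: "X i \<in> borel_measurable M" if "i \<in> I" for i
    using X[OF that] by (simp add: normal_rv_def)
  \<comment> \<open>The weights s i / \<tau> sum to 1 and cancel \<open>s i\<close> in the
    exponents, so that the convex combination of the exponents is exactly the exponent of
    \<open>?f\<close>.\<close>
  let ?g = "\<lambda>x. \<Sum>i\<in>I. (s i / \<tau>) * exp ((X i x)\<^sup>2 / (4 * s i))"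
  have le: "?f x \<le> ?g x" for x
  proof -
    have "exp (\<Sum>i\<in>I. (s i / \<tau>) *\<^sub>R ((X i x)\<^sup>2 / (4 * s i))) \<le> ?g x"
      using I s \<tau>pos
      by (intro convex_on_sum[OF _ _ exp_convex])
         (auto simp: \<tau> sum_divide_distrib[symmetric] less_imp_le)
    also have "(\<Sum>i\<in>I. (s i / \<tau>) *\<^sub>R ((X i x)\<^sup>2 / (4 * s i))) = (\<Sum>i\<in>I. (X i x)\<^sup>2 / (4 * \<tau>))"
    proof (rule sum.cong)
      fix i assume "i \<in> I"
      thus "(s i / \<tau>) *\<^sub>R ((X i x)\<^sup>2 / (4 * s i)) = (X i x)\<^sup>2 / (4 * \<tau>)"
        using s[of i] \<tau>pos by simp
    qed simp
    finally show ?thesis by (simp add: sum_divide_distrib)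
  qed
  have g: "has_bochner_integral M ?g (\<Sum>i\<in>I. (s i / \<tau>) * sqrt 2)"
    using X s by (intro has_bochner_integral_sum has_bochner_integral_mult_right normal_rv_exp_square) auto
  show int: "integrable M ?f"
  proof (rule Bochner_Integration.integrable_bound)
    show "integrable M ?g" using g by (simp add: has_bochner_integral_iff)
    show "AE x in M. norm (?f x) \<le> norm (?g x)"
      using le by (intro AE_I2) (auto intro: order_trans[OF _ abs_ge_self])
  qed measurable
  have "integral\<^sup>L M ?f \<le> integral\<^sup>L M ?g"
    using le int g by (intro integral_mono) (auto simp: has_bochner_integral_iff)
  also have "\<dots> = (\<Sum>i\<in>I. (s i / \<tau>) * sqrt 2)"
    using g by (rule has_bochner_integral_integral_eq)
  also have "\<dots> = (\<Sum>i\<in>I. s i) / \<tau> * sqrt 2"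
    by (simp only: sum_distrib_right sum_divide_distrib)
  also have "\<dots> = sqrt 2" using \<tau> \<tau>pos by simp
  finally show "integral\<^sup>L M ?f \<le> sqrt 2" .
qed

subsection \<open>Measurability of random vectors\<close>

lemma space_borel_vec [simp]: "space (borel_vec n) = carrier_vec n"
  by (simp add: borel_vec_def)

lemma measurable_vec_index:
  assumes "i < n"
  shows "(\<lambda>v. v $ i) \<in> borel_measurable (borel_vec n)"
proof -
  have "(\<lambda>v. \<lambda>i\<in>{..<n}. v $ i) \<in> borel_vec n \<rightarrow>\<^sub>M (\<Pi>\<^sub>M i\<in>{..<n}. (borel :: real measure))"
    unfolding borel_vec_def by (rule measurable_vimage_algebra1) (auto simp: space_PiM)
  from measurable_compose[OF this measurable_component_singleton[of i]]
  show ?thesis using assms by simp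
qed

lemma measurable_borel_vecI:
  assumes "\<And>x. x \<in> space M \<Longrightarrow> f x \<in> carrier_vec n"
    and "\<And>i. i < n \<Longrightarrow> (\<lambda>x. f x $ i) \<in> borel_measurable M"
  shows "f \<in> M \<rightarrow>\<^sub>M borel_vec n"
  unfolding borel_vec_def
  by (rule measurable_vimage_algebra2) (use assms in \<open>auto intro!: measurable_restrict\<close>)

lemma measurable_borel_vec_index:
  assumes "f \<in> M \<rightarrow>\<^sub>M borel_vec n" "i < n"
  shows "(\<lambda>x. f x $ i) \<in> borel_measurable M"
  using measurable_compose[OF assms(1) measurable_vec_index[OF assms(2)]] .

lemma measurable_borel_vec_carrier:
  assumes "f \<in> M \<rightarrow>\<^sub>M borel_vec n" "x \<in> space M"
  shows "f x \<in> carrier_vec n"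
  using measurable_space[OF assms] by simp

lemma measurable_scalar_prod:
  assumes a: "a \<in> carrier_vec n" and f: "f \<in> M \<rightarrow>\<^sub>M borel_vec n"
  shows "(\<lambda>x. a \<bullet> f x) \<in> borel_measurable M"
proof -
  have "(\<lambda>x. \<Sum>i<n. a $ i * f x $ i) \<in> borel_measurable M"
    using measurable_borel_vec_index[OF f] by (intro borel_measurable_sum borel_measurable_times) auto
  moreover have "a \<bullet> f x = (\<Sum>i<n. a $ i * f x $ i)" if "x \<in> space M" for x
    using measurable_borel_vec_carrier[OF f that] by (simp add: scalar_prod_def atLeast0LessThan)
  ultimately show ?thesis by (simp cong: measurable_cong)
qed

lemma measurable_mult_mat_vec:
  assumes A: "A \<in> carrier_mat m n" and f: "f \<in> M \<rightarrow>\<^sub>M borel_vec n"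
  shows "(\<lambda>x. A *\<^sub>v f x) \<in> M \<rightarrow>\<^sub>M borel_vec m"
proof (rule measurable_borel_vecI)
  show "A *\<^sub>v f x \<in> carrier_vec m" if "x \<in> space M" for x
    using A measurable_borel_vec_carrier[OF f that] by (rule mult_mat_vec_carrier)
  show "(\<lambda>x. (A *\<^sub>v f x) $ i) \<in> borel_measurable M" if "i < m" for i
    using that A measurable_scalar_prod[OF row_carrier_vec[OF that A] f] by simp
qed

lemma measurable_vec_add:
  assumes f: "f \<in> M \<rightarrow>\<^sub>M borel_vec n" and g: "g \<in> M \<rightarrow>\<^sub>M borel_vec n"
  shows "(\<lambda>x. f x + g x) \<in> M \<rightarrow>\<^sub>M borel_vec n"
proof (rule measurable_borel_vecI)
  show "f x + g x \<in> carrier_vec n" if "x \<in> space M" for x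
    using measurable_borel_vec_carrier[OF f that] measurable_borel_vec_carrier[OF g that] by simp
  fix i assume i: "i < n"
  have "(\<lambda>x. f x $ i + g x $ i) \<in> borel_measurable M"
    using measurable_borel_vec_index[OF f i] measurable_borel_vec_index[OF g i] by simp
  moreover have "(f x + g x) $ i = f x $ i + g x $ i" if "x \<in> space M" for x
    using i measurable_borel_vec_carrier[OF g that] by simp
  ultimately show "(\<lambda>x. (f x + g x) $ i) \<in> borel_measurable M" by (simp cong: measurable_cong)
qed

lemma measurable_vec_minus:
  assumes f: "f \<in> M \<rightarrow>\<^sub>M borel_vec n" and g: "g \<in> M \<rightarrow>\<^sub>M borel_vec n"
  shows "(\<lambda>x. f x - g x) \<in> M \<rightarrow>\<^sub>M borel_vec n"
proof (rule measurable_borel_vecI)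
  show "f x - g x \<in> carrier_vec n" if "x \<in> space M" for x
    using measurable_borel_vec_carrier[OF f that] measurable_borel_vec_carrier[OF g that] by simp
  fix i assume i: "i < n"
  have "(\<lambda>x. f x $ i - g x $ i) \<in> borel_measurable M"
    using measurable_borel_vec_index[OF f i] measurable_borel_vec_index[OF g i] by simp
  moreover have "(f x - g x) $ i = f x $ i - g x $ i" if "x \<in> space M" for x
    using i measurable_borel_vec_carrier[OF g that] by simp
  ultimately show "(\<lambda>x. (f x - g x) $ i) \<in> borel_measurable M" by (simp cong: measurable_cong)
qed

lemma measurable_euclid_norm:
  assumes f: "f \<in> M \<rightarrow>\<^sub>M borel_vec n"
  shows "(\<lambda>x. euclid_norm (f x)) \<in> borel_measurable M"
proof -
  have "(\<lambda>x. sqrt (\<Sum>i<n. (f x $ i)\<^sup>2)) \<in> borel_measurable M"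
  proof -
    have "(\<lambda>x. \<Sum>i<n. (f x $ i)\<^sup>2) \<in> borel_measurable M"
      using measurable_borel_vec_index[OF f] by (intro borel_measurable_sum borel_measurable_power) auto
    thus ?thesis by measurable
  qed
  moreover have "euclid_norm (f x) = sqrt (\<Sum>i<n. (f x $ i)\<^sup>2)" if "x \<in> space M" for x
    using measurable_borel_vec_carrier[OF f that] by (simp add: euclid_norm_L2 L2_set_def)
  ultimately show ?thesis by (simp cong: measurable_cong)
qed

text \<open>Adds the zero functional, which has no density and is left out in
  \<open>centered_gaussian\<close>. The unrolled trajectory may well produce it, for instance when
  \<open>transpose_mat B\<close> annihilates a vector.\<close>

lemma centered_gaussian_functional:
  assumes \<mu>: "centered_gaussian n S \<mu>" and S: "S \<in> carrier_mat n n"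
    and pos: "\<And>a. a \<in> carrier_vec n \<Longrightarrow> a \<noteq> 0\<^sub>v n \<Longrightarrow> 0 < a \<bullet> (S *\<^sub>v a)"
    and a: "a \<in> carrier_vec n"
  shows "normal_rv \<mu> (\<lambda>x. a \<bullet> x) (a \<bullet> (S *\<^sub>v a))"
proof (cases "a = 0\<^sub>v n")
  case True
  have P: "prob_space \<mu>" and "sets \<mu> = sets (borel_vec n)" using \<mu> by (auto simp: centered_gaussian_def)
  hence "space \<mu> = carrier_vec n" using sets_eq_imp_space_eq[of \<mu> "borel_vec n"] by simp
  hence "normal_rv \<mu> (\<lambda>x. a \<bullet> x) s \<longleftrightarrow> normal_rv \<mu> (\<lambda>_. 0) s" for s
    using True by (intro normal_rv_cong) auto
  moreover have "a \<bullet> (S *\<^sub>v a) = 0" using True S by simp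
  ultimately show ?thesis using normal_rv_zero[OF P] by simp
next
  case False
  have "0 < sqrt (a \<bullet> (S *\<^sub>v a))" using pos[OF a False] by simp
  moreover have "prob_space \<mu>"
    "distributed \<mu> lborel (\<lambda>x. a \<bullet> x) (normal_density 0 (sqrt (a \<bullet> (S *\<^sub>v a))))"
    using \<mu> False a by (auto simp: centered_gaussian_def)
  ultimately have "normal_rv \<mu> (\<lambda>x. a \<bullet> x) ((sqrt (a \<bullet> (S *\<^sub>v a)))\<^sup>2)"
    by (intro distributed_normal_rv)
  thus ?thesis using pos[OF a False] by simp
qed

subsection \<open>Closed-loop trajectories\<close>

lemma closed_loop_0: "closed_loop A B K \<omega> 0 = fst \<omega>"
  by (cases \<omega>) auto

lemma closed_loop_Suc:
  "closed_loop A B K \<omega> (Suc t) =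
     (A + B * K) *\<^sub>v closed_loop A B K \<omega> t + B *\<^sub>v fst (snd \<omega>) t + snd (snd \<omega>) t"
  by (cases \<omega>) auto

locale process_noise =
  fixes n m T :: nat and \<mu>x \<mu>z \<mu>w :: "real Matrix.vec measure"
  assumes prob_x: "prob_space \<mu>x" and prob_z: "prob_space \<mu>z" and prob_w: "prob_space \<mu>w"
    and sets_x: "sets \<mu>x = sets (borel_vec n)" and sets_z: "sets \<mu>z = sets (borel_vec m)"
    and sets_w: "sets \<mu>w = sets (borel_vec n)"
begin

abbreviation P :: "noise measure" where "P \<equiv> noise_law T \<mu>x \<mu>z \<mu>w"

lemma prob_space_z_w: "prob_space ((\<Pi>\<^sub>M t\<in>{..<T}. \<mu>z) \<Otimes>\<^sub>M (\<Pi>\<^sub>M t\<in>{..<T}. \<mu>w))"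
proof -
  interpret z: prob_space "\<Pi>\<^sub>M t\<in>{..<T}. \<mu>z" using prob_z by (intro prob_space_PiM)
  interpret w: prob_space "\<Pi>\<^sub>M t\<in>{..<T}. \<mu>w" using prob_w by (intro prob_space_PiM)
  interpret pair_prob_space "\<Pi>\<^sub>M t\<in>{..<T}. \<mu>z" "\<Pi>\<^sub>M t\<in>{..<T}. \<mu>w" ..
  show ?thesis by (rule prob_space_axioms)
qed

sublocale noise: prob_space P
proof -
  interpret x: prob_space \<mu>x by (rule prob_x)
  interpret zw: prob_space "(\<Pi>\<^sub>M t\<in>{..<T}. \<mu>z) \<Otimes>\<^sub>M (\<Pi>\<^sub>M t\<in>{..<T}. \<mu>w)" by (rule prob_space_z_w)
  interpret pair_prob_space \<mu>x "(\<Pi>\<^sub>M t\<in>{..<T}. \<mu>z) \<Otimes>\<^sub>M (\<Pi>\<^sub>M t\<in>{..<T}. \<mu>w)" ..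
  show "prob_space P" unfolding noise_law_def by (rule prob_space_axioms)
qed

lemma measurable_x0: "fst \<in> P \<rightarrow>\<^sub>M borel_vec n"
  unfolding noise_law_def using measurable_fst measurable_cong_sets[OF refl sets_x] by blast

lemma measurable_z:
  assumes "t < T" shows "(\<lambda>\<omega>. fst (snd \<omega>) t) \<in> P \<rightarrow>\<^sub>M borel_vec m"
proof -
  have "(\<lambda>\<omega>. fst (snd \<omega>) t) \<in> P \<rightarrow>\<^sub>M \<mu>z"
    unfolding noise_law_def
    by (rule measurable_compose[OF measurable_compose[OF measurable_snd measurable_fst]
          measurable_component_singleton]) (use assms in simp)
  thus ?thesis using measurable_cong_sets[OF refl sets_z] by blast
qed

lemma measurable_w:
  assumes "t < T" shows "(\<lambda>\<omega>. snd (snd \<omega>) t) \<in> P \<rightarrow>\<^sub>M borel_vec n"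
proof -
  have "(\<lambda>\<omega>. snd (snd \<omega>) t) \<in> P \<rightarrow>\<^sub>M \<mu>w"
    unfolding noise_law_def
    by (rule measurable_compose[OF measurable_compose[OF measurable_snd measurable_snd]
          measurable_component_singleton]) (use assms in simp)
  thus ?thesis using measurable_cong_sets[OF refl sets_w] by blast
qed

lemmas z_carrier = measurable_borel_vec_carrier[OF measurable_z]
lemmas w_carrier = measurable_borel_vec_carrier[OF measurable_w]

lemma measurable_closed_loop:
  assumes A: "A \<in> carrier_mat n n" and B: "B \<in> carrier_mat n m" and K: "K \<in> carrier_mat m n"
    and t: "t \<le> T"
  shows "(\<lambda>\<omega>. closed_loop A B K \<omega> t) \<in> P \<rightarrow>\<^sub>M borel_vec n"
  using t
proof (induction t)
  case 0
  thus ?case using measurable_x0 by (simp add: closed_loop_0)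
next
  case (Suc t)
  have "A + B * K \<in> carrier_mat n n" using A B K by simp
  thus ?case unfolding closed_loop_Suc using Suc
    by (intro measurable_vec_add measurable_mult_mat_vec[OF _ Suc.IH] measurable_mult_mat_vec[OF B]
        measurable_z measurable_w) auto
qed

lemmas closed_loop_carrier = measurable_borel_vec_carrier[OF measurable_closed_loop]

text \<open>Two recursions are unrolled with the same coefficients: the trajectory, as a sum of
  functionals of separate noise coordinates, and the Lyapunov equation, as the sum of the variances
  of these functionals. This settles the variance by algebra alone; an induction on the law of the
  state would need its independence of the later noise at every step.\<close>

lemma closed_loop_functional:
  assumes A: "A \<in> carrier_mat n n" and B: "B \<in> carrier_mat n m" and K: "K \<in> carrier_mat m n"
    and S: "S \<in> carrier_mat n n" and W: "W \<in> carrier_mat n n"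
    and eq: "S = (A + B * K) * S * transpose_mat (A + B * K) + c \<cdot>\<^sub>m (B * transpose_mat B) + W"
    and a: "a \<in> carrier_vec n" and t: "t \<le> T"
  shows "\<exists>p q r. p \<in> carrier_vec n \<and> (\<forall>s. q s \<in> carrier_vec m) \<and> (\<forall>s. r s \<in> carrier_vec n) \<and>
    (\<forall>\<omega>\<in>space P. a \<bullet> closed_loop A B K \<omega> t =
       p \<bullet> fst \<omega> + ((\<Sum>s<t. q s \<bullet> fst (snd \<omega>) s) + (\<Sum>s<t. r s \<bullet> snd (snd \<omega>) s))) \<and>
    a \<bullet> (S *\<^sub>v a) = p \<bullet> (S *\<^sub>v p) + ((\<Sum>s<t. c * (q s \<bullet> q s)) + (\<Sum>s<t. r s \<bullet> (W *\<^sub>v r s)))"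
  using a t
proof (induction t arbitrary: a)
  case 0
  thus ?case
    by (intro exI[of _ a] exI[of _ "\<lambda>_. 0\<^sub>v m"] exI[of _ "\<lambda>_. 0\<^sub>v n"]) (auto simp: closed_loop_0)
next
  case (Suc t)
  let ?M = "A + B * K"
  have M: "?M \<in> carrier_mat n n" using A B K by simp
  let ?a = "transpose_mat ?M *\<^sub>v a" and ?b = "transpose_mat B *\<^sub>v a"
  have a: "a \<in> carrier_vec n" by fact
  have a': "?a \<in> carrier_vec n" using M a by (meson mult_mat_vec_carrier transpose_carrier_mat)
  have b: "?b \<in> carrier_vec m" using B a by (meson mult_mat_vec_carrier transpose_carrier_mat)
  obtain p q r where pqr: "p \<in> carrier_vec n" "\<forall>s. q s \<in> carrier_vec m" "\<forall>s. r s \<in> carrier_vec n"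
    and val: "\<forall>\<omega>\<in>space P. ?a \<bullet> closed_loop A B K \<omega> t =
       p \<bullet> fst \<omega> + ((\<Sum>s<t. q s \<bullet> fst (snd \<omega>) s) + (\<Sum>s<t. r s \<bullet> snd (snd \<omega>) s))"
    and var: "?a \<bullet> (S *\<^sub>v ?a) = p \<bullet> (S *\<^sub>v p) + ((\<Sum>s<t. c * (q s \<bullet> q s)) + (\<Sum>s<t. r s \<bullet> (W *\<^sub>v r s)))"
    using Suc.IH[OF a' Suc_leD[OF Suc.prems(2)]] by (elim exE conjE) (rule that)
  \<comment> \<open>The newest noise at time t is seen through
    \<open>transpose_mat B *\<^sub>v a\<close> and through \<open>a\<close> itself; all earlier
    coefficients come from the pulled-back functional.\<close>
  define q' where "q' = q(t := ?b)"
  define r' where "r' = r(t := a)"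
  have val': "a \<bullet> closed_loop A B K \<omega> (Suc t) =
      p \<bullet> fst \<omega> + ((\<Sum>s<Suc t. q' s \<bullet> fst (snd \<omega>) s) + (\<Sum>s<Suc t. r' s \<bullet> snd (snd \<omega>) s))"
    if \<omega>: "\<omega> \<in> space P" for \<omega>
  proof -
    have x: "closed_loop A B K \<omega> t \<in> carrier_vec n"
      using Suc.prems by (intro closed_loop_carrier[OF A B K _ \<omega>]) simp
    have z: "fst (snd \<omega>) t \<in> carrier_vec m" and w: "snd (snd \<omega>) t \<in> carrier_vec n"
      using z_carrier[OF _ \<omega>] w_carrier[OF _ \<omega>] Suc.prems by auto
    have Mx: "?M *\<^sub>v closed_loop A B K \<omega> t \<in> carrier_vec n" using M x by (rule mult_mat_vec_carrier)
    have Bz: "B *\<^sub>v fst (snd \<omega>) t \<in> carrier_vec n" using B z by (rule mult_mat_vec_carrier)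
    have "a \<bullet> closed_loop A B K \<omega> (Suc t) = a \<bullet> (?M *\<^sub>v closed_loop A B K \<omega> t)
        + a \<bullet> (B *\<^sub>v fst (snd \<omega>) t) + a \<bullet> snd (snd \<omega>) t"
      unfolding closed_loop_Suc scalar_prod_add_distrib[OF a add_carrier_vec[OF Mx Bz] w]
        scalar_prod_add_distrib[OF a Mx Bz] ..
    also have "\<dots> = ?a \<bullet> closed_loop A B K \<omega> t + ?b \<bullet> fst (snd \<omega>) t + a \<bullet> snd (snd \<omega>) t"
      unfolding transpose_vec_mult_scalar[OF M x a] transpose_vec_mult_scalar[OF B z a] ..
    finally show ?thesis unfolding bspec[OF val \<omega>] by (simp add: q'_def r'_def)
  qed
  have cBB: "c \<cdot>\<^sub>m (B * transpose_mat B) \<in> carrier_mat n n" using B by simp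
  have Q: "c \<cdot>\<^sub>m (B * transpose_mat B) + W \<in> carrier_mat n n" using cBB W by simp
  have C: "?M * S * transpose_mat ?M \<in> carrier_mat n n"
    using M S by (meson mult_carrier_mat transpose_carrier_mat)
  have "S = ?M * S * transpose_mat ?M + (c \<cdot>\<^sub>m (B * transpose_mat B) + W)"
    by (rule trans[OF eq assoc_add_mat[OF C cBB W]])
  from lyapunov_step[OF M S Q this a a]
  have "a \<bullet> (S *\<^sub>v a) = ?a \<bullet> (S *\<^sub>v ?a) + a \<bullet> ((c \<cdot>\<^sub>m (B * transpose_mat B) + W) *\<^sub>v a)" .
  also have "a \<bullet> ((c \<cdot>\<^sub>m (B * transpose_mat B) + W) *\<^sub>v a) = c * (?b \<bullet> ?b) + a \<bullet> (W *\<^sub>v a)"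
    by (rule gram_add_form[OF B W a])
  finally have var': "a \<bullet> (S *\<^sub>v a) = p \<bullet> (S *\<^sub>v p)
      + ((\<Sum>s<Suc t. c * (q' s \<bullet> q' s)) + (\<Sum>s<Suc t. r' s \<bullet> (W *\<^sub>v r' s)))"
    unfolding var by (simp add: q'_def r'_def)
  have "\<forall>s. q' s \<in> carrier_vec m" "\<forall>s. r' s \<in> carrier_vec n"
    using pqr b a by (auto simp: q'_def r'_def)
  thus ?case using pqr(1) val' var' by blast
qed

end

context process_noise
begin

text \<open>Stationarity: the variance is the same for every t. Independence is used only here,
  through the nested product that defines \<open>noise_law\<close>.\<close>

lemma closed_loop_normal:
  assumes A: "A \<in> carrier_mat n n" and B: "B \<in> carrier_mat n m" and K: "K \<in> carrier_mat m n"
    and S: "S \<in> carrier_mat n n" and W: "W \<in> carrier_mat n n"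
    and eq: "S = (A + B * K) * S * transpose_mat (A + B * K) + c \<cdot>\<^sub>m (B * transpose_mat B) + W"
    and x: "\<And>a. a \<in> carrier_vec n \<Longrightarrow> normal_rv \<mu>x (\<lambda>x. a \<bullet> x) (a \<bullet> (S *\<^sub>v a))"
    and z: "\<And>a. a \<in> carrier_vec m \<Longrightarrow> normal_rv \<mu>z (\<lambda>x. a \<bullet> x) (c * (a \<bullet> a))"
    and w: "\<And>a. a \<in> carrier_vec n \<Longrightarrow> normal_rv \<mu>w (\<lambda>x. a \<bullet> x) (a \<bullet> (W *\<^sub>v a))"
    and a: "a \<in> carrier_vec n" and t: "t \<le> T"
  shows "normal_rv P (\<lambda>\<omega>. a \<bullet> closed_loop A B K \<omega> t) (a \<bullet> (S *\<^sub>v a))"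
proof -
  obtain p q r where pqr: "p \<in> carrier_vec n" "\<forall>s. q s \<in> carrier_vec m" "\<forall>s. r s \<in> carrier_vec n"
    and val: "\<forall>\<omega>\<in>space P. a \<bullet> closed_loop A B K \<omega> t =
       p \<bullet> fst \<omega> + ((\<Sum>s<t. q s \<bullet> fst (snd \<omega>) s) + (\<Sum>s<t. r s \<bullet> snd (snd \<omega>) s))"
    and var: "a \<bullet> (S *\<^sub>v a) = p \<bullet> (S *\<^sub>v p) + ((\<Sum>s<t. c * (q s \<bullet> q s)) + (\<Sum>s<t. r s \<bullet> (W *\<^sub>v r s)))"
    using closed_loop_functional[OF A B K S W eq a t] by (elim exE conjE) (rule that)
  have t': "{..<t} \<subseteq> {..<T}" using t by auto
  have "normal_rv P (\<lambda>\<omega>. p \<bullet> fst \<omega> + ((\<Sum>s<t. q s \<bullet> fst (snd \<omega>) s) + (\<Sum>s<t. r s \<bullet> snd (snd \<omega>) s)))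
      (p \<bullet> (S *\<^sub>v p) + ((\<Sum>s<t. c * (q s \<bullet> q s)) + (\<Sum>s<t. r s \<bullet> (W *\<^sub>v r s))))"
    unfolding noise_law_def
    by (rule normal_rv_pair[OF x[OF pqr(1)]
          normal_rv_pair[OF normal_rv_PiM_subset[OF _ t' prob_z z] normal_rv_PiM_subset[OF _ t' prob_w w]]])
       (use pqr in auto)
  thus ?thesis unfolding var by (rule normal_rv_cong[THEN iffD2, rotated]) (rule bspec[OF val])
qed

end

text \<open>The power \<open>M ^\<^sub>m j\<close> in front strengthens the induction: each step
  back in time raises j by one, so the bound collects norms of powers. A direct triangle inequality
  would collect powers of the norm, which need not be summable.\<close>

lemma linear_recursion_pow_bound:
  assumes M: "M \<in> carrier_mat n n" and e0: "e 0 = 0\<^sub>v n"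
    and step: "\<And>s. s < t \<Longrightarrow> e (Suc s) = M *\<^sub>v e s + u s"
    and u: "\<And>s. s < t \<Longrightarrow> u s \<in> carrier_vec n" and U: "\<And>s. s < t \<Longrightarrow> euclid_norm (u s) \<le> U"
  shows "e t \<in> carrier_vec n \<and> euclid_norm (M ^\<^sub>m j *\<^sub>v e t) \<le> U * (\<Sum>i<t. spectral_norm (M ^\<^sub>m (j + i)))"
  using step u U
proof (induction t arbitrary: j)
  case 0
  show ?case
    using euclid_norm_mult_spectral[OF pow_carrier_mat[OF M, of j] zero_carrier_vec] by (simp add: e0)
next
  case (Suc t)
  have IH: "e t \<in> carrier_vec n"
    "euclid_norm (M ^\<^sub>m Suc j *\<^sub>v e t) \<le> U * (\<Sum>i<t. spectral_norm (M ^\<^sub>m (Suc j + i)))"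
    using Suc.IH[of "Suc j"] Suc.prems by (metis less_SucI)+
  have Mj: "M ^\<^sub>m j \<in> carrier_mat n n" using M by (rule pow_carrier_mat)
  have Me: "M *\<^sub>v e t \<in> carrier_vec n" using M IH(1) by (rule mult_mat_vec_carrier)
  have ut: "u t \<in> carrier_vec n" "euclid_norm (u t) \<le> U" using Suc.prems(2,3) by auto
  have e: "e (Suc t) = M *\<^sub>v e t + u t" using Suc.prems(1) by simp
  have "M ^\<^sub>m j *\<^sub>v e (Suc t) = M ^\<^sub>m Suc j *\<^sub>v e t + M ^\<^sub>m j *\<^sub>v u t"
    unfolding e mult_add_distrib_mat_vec[OF Mj Me ut(1)]
    using assoc_mult_mat_vec[OF Mj M IH(1)] by simp
  hence "euclid_norm (M ^\<^sub>m j *\<^sub>v e (Suc t))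
      \<le> euclid_norm (M ^\<^sub>m Suc j *\<^sub>v e t) + euclid_norm (M ^\<^sub>m j *\<^sub>v u t)"
    using euclid_norm_triangle[OF mult_mat_vec_carrier[OF pow_carrier_mat[OF M, of "Suc j"] IH(1)]
        mult_mat_vec_carrier[OF Mj ut(1)]] by simp
  also have "euclid_norm (M ^\<^sub>m j *\<^sub>v u t) \<le> U * spectral_norm (M ^\<^sub>m j)"
    using euclid_norm_mult_spectral[OF Mj ut(1)] mult_left_mono[OF ut(2) spectral_norm_nonneg[of "M ^\<^sub>m j"]]
    by (simp add: mult.commute)
  finally have "euclid_norm (M ^\<^sub>m j *\<^sub>v e (Suc t))
      \<le> U * (\<Sum>i<t. spectral_norm (M ^\<^sub>m (Suc j + i))) + U * spectral_norm (M ^\<^sub>m j)"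
    using IH(2) by linarith
  also have "\<dots> = U * (\<Sum>i<Suc t. spectral_norm (M ^\<^sub>m (j + i)))"
    unfolding sum.lessThan_Suc_shift by (simp add: distrib_left)
  finally show ?case using e Me ut(1) by simp
qed

lemma linear_recursion_bound:
  assumes M: "M \<in> carrier_mat n n" and n: "0 < n"
    and sr: "spectral_radius (map_mat complex_of_real M) < 1" and e0: "e 0 = 0\<^sub>v n"
    and step: "\<And>s. s < t \<Longrightarrow> e (Suc s) = M *\<^sub>v e s + u s"
    and u: "\<And>s. s < t \<Longrightarrow> u s \<in> carrier_vec n" and U: "\<And>s. s < t \<Longrightarrow> euclid_norm (u s) \<le> U"
    and U0: "0 \<le> U"
  shows "euclid_norm (e t) \<le> \<J> M * U"
proof -
  have e: "e t \<in> carrier_vec n"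
    and *: "euclid_norm (M ^\<^sub>m 0 *\<^sub>v e t) \<le> U * (\<Sum>i<t. spectral_norm (M ^\<^sub>m (0 + i)))"
    using linear_recursion_pow_bound[OF M e0 step u U, of t 0] by auto
  have "M ^\<^sub>m 0 *\<^sub>v e t = e t" using M e by simp
  with * have "euclid_norm (e t) \<le> U * (\<Sum>i<t. spectral_norm (M ^\<^sub>m i))" by simp
  also have "\<dots> \<le> U * \<J> M"
    unfolding \<J>_def using U0
    by (intro mult_left_mono sum_le_suminf summable_spectral_norm_pow[OF M n sr])
       (auto simp: spectral_norm_nonneg)
  finally show ?thesis by (simp add: mult.commute)
qed

text \<open>A small-gain argument: the feedback of the error into itself has gain at most \<open>1/2\<close>.\<close>

lemma perturbed_recursion_bound:
  assumes M: "M \<in> carrier_mat n n" and n: "0 < n"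
    and sr: "spectral_radius (map_mat complex_of_real M) < 1"
    and B: "B \<in> carrier_mat n m" and D: "D \<in> carrier_mat m n"
    and gain: "\<J> M * spectral_norm B * frobenius_norm D \<le> 1 / 2"
    and e0: "e 0 = 0\<^sub>v n" and e: "\<And>t. t \<le> T \<Longrightarrow> e t \<in> carrier_vec n"
    and x: "\<And>t. t < T \<Longrightarrow> x t \<in> carrier_vec n"
    and step: "\<And>t. t < T \<Longrightarrow> e (Suc t) = M *\<^sub>v e t + B *\<^sub>v (D *\<^sub>v (x t - e t))"
    and R: "\<And>t. t < T \<Longrightarrow> euclid_norm (D *\<^sub>v x t) \<le> R" "0 \<le> R"
    and t: "t \<le> T"
  shows "euclid_norm (e t) \<le> 2 * \<J> M * spectral_norm B * R"
  using t
\<comment> \<open>Strong induction, since the error at time t collects the inputs of all earlier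
  times.\<close>
proof (induction t rule: less_induct)
  case (less t)
  let ?b = "spectral_norm B" and ?J = "\<J> M"
  have J: "0 \<le> ?J" by (rule J_nonneg[OF M n sr])
  have b: "0 \<le> ?b" by (rule spectral_norm_nonneg)
  have U: "euclid_norm (B *\<^sub>v (D *\<^sub>v (x s - e s))) \<le> 2 * ?b * R" if s: "s < t" for s
  proof -
    have xs: "x s \<in> carrier_vec n" and es: "e s \<in> carrier_vec n" using x e s less.prems by auto
    have Dx: "D *\<^sub>v x s \<in> carrier_vec m" and De: "D *\<^sub>v e s \<in> carrier_vec m"
      using mult_mat_vec_carrier[OF D] xs es by auto
    have "D *\<^sub>v (x s - e s) = D *\<^sub>v x s + (- 1) \<cdot>\<^sub>v (D *\<^sub>v e s)"
      unfolding mult_minus_distrib_mat_vec[OF D xs es] using Dx De by (intro eq_vecI) auto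
    hence "euclid_norm (D *\<^sub>v (x s - e s)) \<le> euclid_norm (D *\<^sub>v x s) + euclid_norm (D *\<^sub>v e s)"
      using euclid_norm_triangle[OF Dx, of "(- 1) \<cdot>\<^sub>v (D *\<^sub>v e s)"] De by (simp add: euclid_norm_smult)
    also have "euclid_norm (D *\<^sub>v e s) \<le> frobenius_norm D * euclid_norm (e s)"
      using D es by (intro euclid_norm_mult_frobenius) auto
    also have "\<dots> \<le> frobenius_norm D * (2 * ?J * ?b * R)"
      using less.IH[OF s] s less.prems by (intro mult_left_mono) (auto simp: frobenius_norm_nonneg)
    \<comment> \<open>The factor 2 reproduces itself: with gain at most 1/2, an error of size 2 J b
      R feeds back at most R into the input, and R + R = 2 R.\<close>
    also have "\<dots> = 2 * (?J * ?b * frobenius_norm D) * R" by simp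
    also have "\<dots> \<le> 1 * R" using gain R(2) by (intro mult_right_mono) auto
    finally have "euclid_norm (D *\<^sub>v (x s - e s)) \<le> 2 * R"
      using R(1)[of s] s less.prems by simp
    hence "?b * euclid_norm (D *\<^sub>v (x s - e s)) \<le> ?b * (2 * R)"
      using b by (rule mult_left_mono)
    thus ?thesis
      using euclid_norm_mult_spectral[OF B mult_mat_vec_carrier[OF D minus_carrier_vec[OF xs es]]] by simp
  qed
  have "euclid_norm (e t) \<le> ?J * (2 * ?b * R)"
  proof (rule linear_recursion_bound[where e = e and u = "\<lambda>s. B *\<^sub>v (D *\<^sub>v (x s - e s))", OF M n sr e0])
    show "e (Suc s) = M *\<^sub>v e s + B *\<^sub>v (D *\<^sub>v (x s - e s))" if "s < t" for s
      using step[of s] that less.prems by simp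
    show "B *\<^sub>v (D *\<^sub>v (x s - e s)) \<in> carrier_vec n" if "s < t" for s
      using that less.prems x[of s] e[of s]
      by (intro mult_mat_vec_carrier[OF B] mult_mat_vec_carrier[OF D] minus_carrier_vec) auto
  qed (use U b R(2) in auto)
  thus ?case by (simp add: mult_ac)
qed

lemma abs_integral_diff_le:
  fixes X Y :: "'a \<Rightarrow> real"
  assumes [measurable]: "X \<in> borel_measurable M" "Y \<in> borel_measurable M" and g: "integrable M g"
    and le: "\<And>x. x \<in> space M \<Longrightarrow> \<bar>X x - Y x\<bar> \<le> g x"
  shows "\<bar>integral\<^sup>L M X - integral\<^sup>L M Y\<bar> \<le> integral\<^sup>L M g"
proof -
  have d: "integrable M (\<lambda>x. X x - Y x)"
    by (rule Bochner_Integration.integrable_bound[OF g]) (use le in \<open>auto intro!: AE_I2 order_trans[OF _ abs_ge_self]\<close>)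
  have *: "integral\<^sup>L M X - integral\<^sup>L M Y = (if integrable M Y then (\<integral>x. X x - Y x \<partial>M) else 0)"
  proof (cases "integrable M Y")
    case True
    have "integrable M (\<lambda>x. (X x - Y x) + Y x)" using d True by (rule Bochner_Integration.integrable_add)
    thus ?thesis using True by simp
  next
    case False
    have "\<not> integrable M X"
    proof
      assume "integrable M X"
      hence "integrable M (\<lambda>x. X x - (X x - Y x))" using d by (rule Bochner_Integration.integrable_diff)
      thus False using False by simp
    qed
    thus ?thesis using False by (simp add: not_integrable_integral_eq)
  qed
  have "\<bar>\<integral>x. X x - Y x \<partial>M\<bar> \<le> (\<integral>x. \<bar>X x - Y x\<bar> \<partial>M)" by (rule integral_abs_bound)
  also have "\<dots> \<le> integral\<^sup>L M g"
    using d g le by (intro integral_mono) auto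
  finally have **: "\<bar>\<integral>x. X x - Y x \<partial>M\<bar> \<le> integral\<^sup>L M g" .
  show ?thesis
  proof (cases "integrable M Y")
    case True
    thus ?thesis using ** unfolding * by (simp only: if_True)
  next
    case False
    \<comment> \<open>Both integrals are 0 by default here; the bound remains true because the
      estimate of the integrated difference forces the right-hand side to be nonnegative.\<close>
    thus ?thesis using ** unfolding * by (simp only: if_False abs_zero)
  qed
qed

subsection \<open>Comparison of the two closed loops\<close>

text \<open>The common noise cancels. The learned state is deliberately written as x - (x - y), the
  expert state minus the error, so that the forcing splits into a stationary signal and a feedback
  of the error.\<close>

lemma closed_loop_difference_step:
  fixes A B :: "real Matrix.mat"
  assumes A: "A \<in> carrier_mat n n" and B: "B \<in> carrier_mat n m"
    and K: "K \<in> carrier_mat m n" and K': "K' \<in> carrier_mat m n"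
    and x: "x \<in> carrier_vec n" and y: "y \<in> carrier_vec n"
    and z: "z \<in> carrier_vec m" and w: "w \<in> carrier_vec n"
  shows "((A + B * K) *\<^sub>v x + B *\<^sub>v z + w) - ((A + B * K') *\<^sub>v y + B *\<^sub>v z + w)
       = (A + B * K) *\<^sub>v (x - y) + B *\<^sub>v ((K - K') *\<^sub>v (x - (x - y)))"
proof -
  have M: "A + B * K \<in> carrier_mat n n" using A B K by simp
  have xy: "x - (x - y) = y" using x y by (intro eq_vecI) auto
  note carr = mult_mat_vec_carrier[OF A y] mult_mat_vec_carrier[OF K y] mult_mat_vec_carrier[OF K' y]
    mult_mat_vec_carrier[OF B z] mult_mat_vec_carrier[OF M x]
  note carr' = carr mult_mat_vec_carrier[OF B carr(2)] mult_mat_vec_carrier[OF B carr(3)]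
  have 1: "(A + B * K') *\<^sub>v y = A *\<^sub>v y + B *\<^sub>v (K' *\<^sub>v y)"
    using add_mult_distrib_mat_vec[OF A mult_carrier_mat[OF B K'] y] assoc_mult_mat_vec[OF B K' y] by simp
  have 2: "(A + B * K) *\<^sub>v (x - y) = (A + B * K) *\<^sub>v x - (A *\<^sub>v y + B *\<^sub>v (K *\<^sub>v y))"
    using mult_minus_distrib_mat_vec[OF M x y]
      add_mult_distrib_mat_vec[OF A mult_carrier_mat[OF B K] y] assoc_mult_mat_vec[OF B K y] by simp
  have 3: "B *\<^sub>v ((K - K') *\<^sub>v y) = B *\<^sub>v (K *\<^sub>v y) - B *\<^sub>v (K' *\<^sub>v y)"
    using mult_minus_distrib_mat_vec[OF B carr(2,3)] minus_mult_distrib_mat_vec[OF K K' y] by simp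
  have alg: "(p + q + w) - ((a + b') + q + w) = (p - (a + b)) + (b - b')"
    if "p \<in> carrier_vec n" "q \<in> carrier_vec n" "a \<in> carrier_vec n" "b \<in> carrier_vec n" "b' \<in> carrier_vec n"
    for p q a b b' :: "real Matrix.vec"
    using that w by (intro eq_vecI) auto
  show ?thesis unfolding xy 1 2 3 by (rule alg[OF carr'(5,4,1,6,7)])
qed

locale closed_loop_comparison = process_noise +
  fixes A B K K' S W :: "real Matrix.mat" and c :: real
  assumes n_pos: "0 < n" and T_pos: "1 \<le> T"
    and A: "A \<in> carrier_mat n n" and B: "B \<in> carrier_mat n m"
    and K: "K \<in> carrier_mat m n" and K': "K' \<in> carrier_mat m n"
    and S: "S \<in> carrier_mat n n" and W: "W \<in> carrier_mat n n"
    and stable: "spectral_radius (map_mat complex_of_real (A + B * K)) < 1"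
    and lyapunov: "S = (A + B * K) * S * transpose_mat (A + B * K) + c \<cdot>\<^sub>m (B * transpose_mat B) + W"
    and S_sym: "\<And>a b. a \<in> carrier_vec n \<Longrightarrow> b \<in> carrier_vec n \<Longrightarrow> a \<bullet> (S *\<^sub>v b) = b \<bullet> (S *\<^sub>v a)"
    and S_pos: "\<And>a. a \<in> carrier_vec n \<Longrightarrow> a \<noteq> 0\<^sub>v n \<Longrightarrow> 0 < a \<bullet> (S *\<^sub>v a)"
    and normal_x: "\<And>a. a \<in> carrier_vec n \<Longrightarrow> normal_rv \<mu>x (\<lambda>x. a \<bullet> x) (a \<bullet> (S *\<^sub>v a))"
    and normal_z: "\<And>a. a \<in> carrier_vec m \<Longrightarrow> normal_rv \<mu>z (\<lambda>x. a \<bullet> x) (c * (a \<bullet> a))"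
    and normal_w: "\<And>a. a \<in> carrier_vec n \<Longrightarrow> normal_rv \<mu>w (\<lambda>x. a \<bullet> x) (a \<bullet> (W *\<^sub>v a))"
begin

abbreviation "D \<equiv> K - K'"
abbreviation "xs \<equiv> closed_loop A B K"
abbreviation "xh \<equiv> closed_loop A B K'"
abbreviation "J \<equiv> \<J> (A + B * K)"
abbreviation "b \<equiv> spectral_norm B"

definition nonzero_rows :: "nat set" where "nonzero_rows = {i. i < m \<and> row D i \<noteq> 0\<^sub>v n}"

definition \<tau> :: real where "\<tau> = (\<Sum>i\<in>nonzero_rows. row D i \<bullet> (S *\<^sub>v row D i))"

lemma D: "D \<in> carrier_mat m n" using K' by (rule minus_carrier_mat)

lemma row_D: "i < m \<Longrightarrow> row D i \<in> carrier_vec n"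
  by (rule row_carrier_vec[OF _ D])

lemma finite_nonzero_rows: "finite nonzero_rows" by (simp add: nonzero_rows_def)

lemma row_D_pos: "i \<in> nonzero_rows \<Longrightarrow> 0 < row D i \<bullet> (S *\<^sub>v row D i)"
  using S_pos row_D by (auto simp: nonzero_rows_def)

lemma \<tau>_nonneg: "0 \<le> \<tau>"
  unfolding \<tau>_def using row_D_pos by (intro sum_nonneg) (simp add: less_imp_le)

lemma row_D_normal:
  assumes "i \<in> nonzero_rows" "t \<le> T"
  shows "normal_rv P (\<lambda>\<omega>. row D i \<bullet> xs \<omega> t) (row D i \<bullet> (S *\<^sub>v row D i))"
  using assms row_D
  by (intro closed_loop_normal[OF A B K S W lyapunov normal_x normal_z normal_w]) (auto simp: nonzero_rows_def)

lemma J_nn: "0 \<le> J"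
  by (rule J_nonneg[OF _ n_pos stable, of]) (use A B K in simp)

lemma norm_D_sq:
  assumes x: "x \<in> carrier_vec n"
  shows "(euclid_norm (D *\<^sub>v x))\<^sup>2 = (\<Sum>i\<in>nonzero_rows. (row D i \<bullet> x)\<^sup>2)"
proof -
  have "(euclid_norm (D *\<^sub>v x))\<^sup>2 = (\<Sum>i<m. (row D i \<bullet> x)\<^sup>2)"
    using D by (auto simp: euclid_norm_sq_sum intro!: sum.cong)
  also have "\<dots> = (\<Sum>i\<in>nonzero_rows. (row D i \<bullet> x)\<^sup>2)"
    using x by (intro sum.mono_neutral_right) (auto simp: nonzero_rows_def)
  finally show ?thesis .
qed

lemma second_moment:
  assumes t: "t \<le> T"
  shows "has_bochner_integral P (\<lambda>\<omega>. (euclid_norm (D *\<^sub>v xs \<omega> t))\<^sup>2) \<tau>"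
proof -
  have "has_bochner_integral P (\<lambda>\<omega>. \<Sum>i\<in>nonzero_rows. (row D i \<bullet> xs \<omega> t)\<^sup>2) \<tau>"
    unfolding \<tau>_def
    by (intro has_bochner_integral_sum normal_rv_second_moment row_D_normal row_D_pos t)
  moreover have "(euclid_norm (D *\<^sub>v xs \<omega> t))\<^sup>2 = (\<Sum>i\<in>nonzero_rows. (row D i \<bullet> xs \<omega> t)\<^sup>2)" if "\<omega> \<in> space P" for \<omega>
    by (rule norm_D_sq[OF closed_loop_carrier[OF A B K t that]])
  ultimately show ?thesis by (simp cong: has_bochner_integral_cong)
qed

text \<open>By stationarity each of the T summands has expectation \<tau>, and the normalisation 1 /
  (2 T) leaves half of it.\<close>

lemma excess_risk_eq: "excess_risk P T A B K K' = \<tau> / 2"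
proof -
  have "has_bochner_integral P (\<lambda>\<omega>. \<Sum>t<T. (euclid_norm (D *\<^sub>v xs \<omega> t))\<^sup>2) (\<Sum>t<T. \<tau>)"
    by (intro has_bochner_integral_sum second_moment) auto
  hence "(\<integral>\<omega>. (\<Sum>t<T. (euclid_norm (D *\<^sub>v xs \<omega> t))\<^sup>2) \<partial>P) = real T * \<tau>"
    by (simp add: has_bochner_integral_integral_eq)
  thus ?thesis using T_pos by (simp add: excess_risk_def)
qed

lemma frobenius_norm_D: "lambda_min S * (frobenius_norm D)\<^sup>2 \<le> \<tau>"
proof -
  have "(frobenius_norm D)\<^sup>2 = (\<Sum>i<m. (euclid_norm (row D i))\<^sup>2)"
    by (simp only: frobenius_norm_sq carrier_matD(1)[OF D])
  also have "\<dots> = (\<Sum>i\<in>nonzero_rows. (euclid_norm (row D i))\<^sup>2)"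
    by (intro sum.mono_neutral_right) (auto simp: nonzero_rows_def)
  finally have "lambda_min S * (frobenius_norm D)\<^sup>2 = (\<Sum>i\<in>nonzero_rows. lambda_min S * (row D i \<bullet> row D i))"
    by (simp add: sum_distrib_left euclid_norm_sq)
  also have "\<dots> \<le> \<tau>"
    unfolding \<tau>_def
    by (intro sum_mono lambda_min_le_rayleigh[OF S n_pos S_sym] row_D) (auto simp: nonzero_rows_def)
  finally show ?thesis .
qed

text \<open>Origin of the constant 1/8: the squared gain times \<open>lambda_min S\<close> is at
  most J^2 b^2 \<tau>, and \<tau> is twice the excess risk, so 2/8 = (1/2)^2 is what remains after
  dividing by \<open>lambda_min S\<close>.\<close>

lemma loop_gain:
  assumes "excess_risk P T A B K K' * (J\<^sup>2 * b\<^sup>2) \<le> 1 / 8 * lambda_min S"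
  shows "J * b * frobenius_norm D \<le> 1 / 2"
proof -
  have pos: "0 < lambda_min S" by (rule lambda_min_pos[OF S n_pos S_sym S_pos])
  have "lambda_min S * (J * b * frobenius_norm D)\<^sup>2 = (J\<^sup>2 * b\<^sup>2) * (lambda_min S * (frobenius_norm D)\<^sup>2)"
    by (simp add: power_mult_distrib mult_ac)
  also have "\<dots> \<le> (J\<^sup>2 * b\<^sup>2) * \<tau>" using frobenius_norm_D by (intro mult_left_mono) auto
  also have "\<dots> \<le> lambda_min S * (1 / 2)\<^sup>2"
    using assms unfolding excess_risk_eq by (simp add: field_simps power2_eq_square)
  finally have "(J * b * frobenius_norm D)\<^sup>2 \<le> (1 / 2)\<^sup>2"
    using pos by (simp only: mult_le_cancel_left_pos)
  thus ?thesis by (rule power2_le_imp_le) simp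
qed

text \<open>A statement about a single realization: the randomness enters through \<open>R\<close>
  alone. The bound up to time T needs the control error \<open>D *\<^sub>v xs \<omega> t\<close>
  only before T.\<close>

lemma tracking_error:
  assumes gain: "J * b * frobenius_norm D \<le> 1 / 2" and \<omega>: "\<omega> \<in> space P"
    and R: "\<And>t. t < T \<Longrightarrow> euclid_norm (D *\<^sub>v xs \<omega> t) \<le> R" "0 \<le> R" and t: "t \<le> T"
  shows "euclid_norm (xh \<omega> t - xs \<omega> t) \<le> 2 * J * b * R"
proof -
  have M: "A + B * K \<in> carrier_mat n n" using A B K by simp
  have xs: "xs \<omega> t \<in> carrier_vec n" if "t \<le> T" for t by (rule closed_loop_carrier[OF A B K that \<omega>])
  have xh: "xh \<omega> t \<in> carrier_vec n" if "t \<le> T" for t by (rule closed_loop_carrier[OF A B K' that \<omega>])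
  have "euclid_norm (xs \<omega> t - xh \<omega> t) \<le> 2 * J * b * R"
  proof (rule perturbed_recursion_bound[where e = "\<lambda>t. xs \<omega> t - xh \<omega> t" and x = "xs \<omega>" and T = T,
        OF M n_pos stable B D gain])
    show "xs \<omega> 0 - xh \<omega> 0 = 0\<^sub>v n"
      using xs[of 0] by (auto simp: closed_loop_0 intro!: eq_vecI)
    show "xs \<omega> (Suc t) - xh \<omega> (Suc t) = (A + B * K) *\<^sub>v (xs \<omega> t - xh \<omega> t)
        + B *\<^sub>v (D *\<^sub>v (xs \<omega> t - (xs \<omega> t - xh \<omega> t)))" if "t < T" for t
      unfolding closed_loop_Suc
      by (rule closed_loop_difference_step[OF A B K K' xs xh z_carrier[OF that \<omega>] w_carrier[OF that \<omega>]])
         (use that in auto)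
  qed (use xs xh R t in auto)
  thus ?thesis using euclid_norm_minus_commute[OF xs[OF t] xh[OF t]] by simp
qed

text \<open>A sum in place of a maximum over t: it dominates each exponential, yet its expectation
  is bounded term by term and grows linearly in T. For \<tau> = 0 the division by zero gives 0 and
  each summand is 1.\<close>

definition Y :: "noise \<Rightarrow> real" where
  "Y \<omega> = (\<Sum>t<T. exp ((euclid_norm (D *\<^sub>v xs \<omega> t))\<^sup>2 / (4 * \<tau>)))"

lemma Y_moment:
  assumes nonzero_rows: "nonzero_rows \<noteq> {}"
  shows "integrable P Y" and "(\<integral>\<omega>. Y \<omega> \<partial>P) \<le> sqrt 2 * real T"
proof -
  let ?f = "\<lambda>t \<omega>. exp ((euclid_norm (D *\<^sub>v xs \<omega> t))\<^sup>2 / (4 * \<tau>))"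
  have *: "integrable P (?f t) \<and> (\<integral>\<omega>. ?f t \<omega> \<partial>P) \<le> sqrt 2" if t: "t < T" for t
  proof -
    have t': "t \<le> T" using t by simp
    have eq: "?f t \<omega> = exp ((\<Sum>i\<in>nonzero_rows. (row D i \<bullet> xs \<omega> t)\<^sup>2) / (4 * \<tau>))" if "\<omega> \<in> space P" for \<omega>
      using norm_D_sq[OF closed_loop_carrier[OF A B K t' that]] by simp
    have "integrable P (\<lambda>\<omega>. exp ((\<Sum>i\<in>nonzero_rows. (row D i \<bullet> xs \<omega> t)\<^sup>2) / (4 * \<tau>)))"
      by (rule normal_rv_exp_sum_squares(1)[OF finite_nonzero_rows nonzero_rows row_D_normal[OF _ t'] row_D_pos \<tau>_def])
    moreover have "integrable P (?f t) \<longleftrightarrow>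
        integrable P (\<lambda>\<omega>. exp ((\<Sum>i\<in>nonzero_rows. (row D i \<bullet> xs \<omega> t)\<^sup>2) / (4 * \<tau>)))"
      by (rule Bochner_Integration.integrable_cong[OF refl eq])
    moreover have "(\<integral>\<omega>. exp ((\<Sum>i\<in>nonzero_rows. (row D i \<bullet> xs \<omega> t)\<^sup>2) / (4 * \<tau>)) \<partial>P) \<le> sqrt 2"
      by (rule normal_rv_exp_sum_squares(2)[OF finite_nonzero_rows nonzero_rows row_D_normal[OF _ t'] row_D_pos \<tau>_def])
    moreover have "(\<integral>\<omega>. ?f t \<omega> \<partial>P) = (\<integral>\<omega>. exp ((\<Sum>i\<in>nonzero_rows. (row D i \<bullet> xs \<omega> t)\<^sup>2) / (4 * \<tau>)) \<partial>P)"
      by (rule Bochner_Integration.integral_cong[OF refl eq])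
    ultimately show ?thesis by (simp only: simp_thms)
  qed
  show "integrable P Y"
    unfolding Y_def using * by (intro Bochner_Integration.integrable_sum) auto
  have "(\<integral>\<omega>. Y \<omega> \<partial>P) = (\<Sum>t<T. \<integral>\<omega>. ?f t \<omega> \<partial>P)"
    unfolding Y_def using * by (intro Bochner_Integration.integral_sum) auto
  also have "\<dots> \<le> (\<Sum>t<T. sqrt 2)" using * by (intro sum_mono) auto
  finally show "(\<integral>\<omega>. Y \<omega> \<partial>P) \<le> sqrt 2 * real T" by (simp add: mult.commute)
qed

text \<open>Keeps \<open>ln (Y \<omega>)\<close> nonnegative, as needed for the square roots below;
  the summand at time 0 is present because \<open>1 \<le> T\<close>.\<close>

lemma Y_ge_1: "1 \<le> Y \<omega>"
proof -
  have "1 \<le> exp ((euclid_norm (D *\<^sub>v xs \<omega> 0))\<^sup>2 / (4 * \<tau>))" using \<tau>_nonneg by simp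
  also have "\<dots> \<le> Y \<omega>"
    unfolding Y_def using T_pos by (intro member_le_sum) auto
  finally show ?thesis .
qed

lemma norm_D_le_Y:
  assumes nonzero_rows: "nonzero_rows \<noteq> {}" and t: "t < T"
  shows "(euclid_norm (D *\<^sub>v xs \<omega> t))\<^sup>2 \<le> 4 * \<tau> * ln (Y \<omega>)"
proof -
  have \<tau>: "0 < \<tau>" unfolding \<tau>_def using nonzero_rows finite_nonzero_rows row_D_pos by (intro sum_pos)
  have "exp ((euclid_norm (D *\<^sub>v xs \<omega> t))\<^sup>2 / (4 * \<tau>)) \<le> Y \<omega>"
    unfolding Y_def using t by (intro member_le_sum) auto
  hence "(euclid_norm (D *\<^sub>v xs \<omega> t))\<^sup>2 / (4 * \<tau>) \<le> ln (Y \<omega>)"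
    using Y_ge_1[of \<omega>] by (simp add: ln_ge_iff)
  thus ?thesis using \<tau> by (simp add: field_simps)
qed

lemma tracking_error_Y:
  assumes gain: "J * b * frobenius_norm D \<le> 1 / 2" and \<omega>: "\<omega> \<in> space P" and t: "t \<le> T"
  shows "euclid_norm (xh \<omega> t - xs \<omega> t) \<le> 2 * J * b * sqrt (4 * \<tau> * ln (Y \<omega>))"
proof (rule tracking_error[OF gain \<omega> _ _ t])
  show "euclid_norm (D *\<^sub>v xs \<omega> t) \<le> sqrt (4 * \<tau> * ln (Y \<omega>))" if t: "t < T" for t
  proof (cases "nonzero_rows = {}")
    \<comment> \<open>Here \<open>D\<close> has no nonzero row, so \<tau> = 0 and both sides
      vanish.\<close>
    case True
    have "(euclid_norm (D *\<^sub>v xs \<omega> t))\<^sup>2 = 0"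
      using norm_D_sq[OF closed_loop_carrier[OF A B K _ \<omega>]] t True by simp
    thus ?thesis using True by (simp add: \<tau>_def)
  next
    case False
    thus ?thesis using norm_D_le_Y[OF False t] by (intro real_le_rsqrt)
  qed
  show "0 \<le> sqrt (4 * \<tau> * ln (Y \<omega>))" using \<tau>_nonneg Y_ge_1[of \<omega>] by simp
qed

section \<open>From the exponential moment to probability and expectation bounds\<close>

lemma measurable_tracking_error:
  assumes "t \<le> T"
  shows "(\<lambda>\<omega>. euclid_norm (xh \<omega> t - xs \<omega> t)) \<in> borel_measurable P"
  by (rule measurable_euclid_norm[OF measurable_vec_minus[OF measurable_closed_loop[OF A B K' assms]
        measurable_closed_loop[OF A B K assms]]])

lemma tracking_high_probability:
  assumes gain: "J * b * frobenius_norm D \<le> 1 / 2" and \<delta>: "0 < \<delta>" "\<delta> < 1" "2 \<le> real T / \<delta>"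
  shows "measure P {\<omega> \<in> space P. (MAX t\<in>{1..T}. (euclid_norm (xh \<omega> t - xs \<omega> t))\<^sup>2)
           \<le> 64 * (J\<^sup>2 * b\<^sup>2 * ln (real T / \<delta>) * excess_risk P T A B K K')} > 1 - \<delta>"
    (is "measure P ?good > _")
proof -
  \<comment> \<open>With the threshold (T / \<delta>)^2, Markov's inequality yields
    \<open>sqrt 2\<close> \<delta>^2 / T, and the logarithm becomes 2 ln (T / \<delta>). The
    constant is 64 = 2^2 * 4 * 2 * 2: the squared factor of the tracking bound, the 4 of the
    exponent, the squared threshold, and \<tau> being twice the excess risk.\<close>
  let ?C = "64 * (J\<^sup>2 * b\<^sup>2 * ln (real T / \<delta>) * excess_risk P T A B K K')" and ?q = "(real T / \<delta>)\<^sup>2"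
  have good: "?good = {\<omega> \<in> space P. \<forall>t\<in>{1..T}. (euclid_norm (xh \<omega> t - xs \<omega> t))\<^sup>2 \<le> ?C}"
    using T_pos by (subst Max_le_iff) auto
  have [measurable]: "(\<lambda>\<omega>. euclid_norm (xh \<omega> t - xs \<omega> t)) \<in> borel_measurable P" if "t \<in> {1..T}" for t
    using that by (intro measurable_tracking_error) auto
  have good_sets: "?good \<in> sets P" unfolding good by measurable
  \<comment> \<open>The comparison of logarithms carries the factor \<tau> so that it is trivially
    true when \<tau> = 0, the case in which \<open>Y\<close> is not estimated.\<close>
  have in_good: "\<omega> \<in> ?good" if \<omega>: "\<omega> \<in> space P" and le: "\<tau> * ln (Y \<omega>) \<le> \<tau> * (2 * ln (real T / \<delta>))" for \<omega>
    unfolding good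
  proof (intro CollectI conjI ballI \<omega>)
    fix t assume "t \<in> {1..T}"
    hence "euclid_norm (xh \<omega> t - xs \<omega> t) \<le> 2 * J * b * sqrt (4 * \<tau> * ln (Y \<omega>))"
      by (intro tracking_error_Y[OF gain \<omega>]) auto
    hence "(euclid_norm (xh \<omega> t - xs \<omega> t))\<^sup>2 \<le> (2 * J * b * sqrt (4 * \<tau> * ln (Y \<omega>)))\<^sup>2"
      by (rule power_mono) simp
    also have "\<dots> = 16 * (J\<^sup>2 * b\<^sup>2) * (\<tau> * ln (Y \<omega>))"
      using \<tau>_nonneg Y_ge_1[of \<omega>] by (simp add: power_mult_distrib)
    also have "\<dots> \<le> 16 * (J\<^sup>2 * b\<^sup>2) * (\<tau> * (2 * ln (real T / \<delta>)))"
      by (rule mult_left_mono[OF le]) simp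
    also have "\<dots> = ?C" unfolding excess_risk_eq by simp
    finally show "(euclid_norm (xh \<omega> t - xs \<omega> t))\<^sup>2 \<le> ?C" .
  qed
  show ?thesis
  proof (cases "nonzero_rows = {}")
    case True
    have "?good = space P" using in_good True by (auto simp: \<tau>_def)
    thus ?thesis using \<delta> noise.prob_space by simp
  next
    case False
    have q: "0 < ?q" using \<delta> T_pos by simp
    let ?bad = "{\<omega> \<in> space P. ?q \<le> Y \<omega>}"
    have [measurable]: "Y \<in> borel_measurable P" using Y_moment(1)[OF False] by (rule borel_measurable_integrable)
    have "measure P ?bad \<le> (\<integral>\<omega>. Y \<omega> \<partial>P) / ?q"
      using Y_moment(1)[OF False] sets.top _ q
      by (rule integral_Markov_inequality_measure) (use Y_ge_1 in \<open>auto intro!: AE_I2 order_trans[OF zero_le_one]\<close>)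
    also have "\<dots> \<le> (sqrt 2 * real T) / ?q"
      using Y_moment(2)[OF False] q by (intro divide_right_mono) auto
    also have "\<dots> = sqrt 2 / (real T / \<delta>) * \<delta>"
      using T_pos \<delta> by (simp add: power2_eq_square field_simps)
    \<comment> \<open>The spare factor \<delta> / T absorbs \<open>sqrt 2\<close>: the condition
      \<open>2 \<le> real T / \<delta>\<close> makes the bound strictly smaller than
      \<delta>.\<close>
    also have "\<dots> < 1 * \<delta>"
    proof (rule mult_strict_right_mono[OF _ \<delta>(1)])
      show "sqrt 2 / (real T / \<delta>) < 1" using \<delta>(3) sqrt2_less_2 by (subst divide_less_eq_1_pos) linarith+
    qed
    finally have bad: "measure P ?bad < \<delta>" by simp
    have "space P - ?bad \<subseteq> ?good"
    proof
      fix \<omega> assume "\<omega> \<in> space P - ?bad"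
      hence \<omega>: "\<omega> \<in> space P" "Y \<omega> < ?q" by auto
      have "ln (Y \<omega>) \<le> ln ?q" using \<omega>(2) Y_ge_1[of \<omega>] q by (subst ln_le_cancel_iff) (auto simp only:)
      also have "\<dots> = 2 * ln (real T / \<delta>)" using \<delta> T_pos by (subst ln_realpow) auto
      finally show "\<omega> \<in> ?good" using \<tau>_nonneg by (intro in_good[OF \<omega>(1)] mult_left_mono)
    qed
    hence "measure P (space P - ?bad) \<le> measure P ?good"
      using good_sets by (rule noise.finite_measure_mono)
    moreover have "measure P (space P - ?bad) = 1 - measure P ?bad"
      by (rule noise.prob_compl) measurable
    ultimately show ?thesis using bad by linarith
  qed
qed

lemma lipschitz_expectation:
  assumes gain: "J * b * frobenius_norm D \<le> 1 / 2" and T2: "2 \<le> T" and h: "traj_lipschitz n T L h"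
  shows "\<bar>(\<integral>x. h x \<partial>traj_law n T P A B K') - (\<integral>x. h x \<partial>traj_law n T P A B K)\<bar>
           \<le> 8 * (L * J * b * sqrt (ln (real T)) * sqrt (excess_risk P T A B K K'))"
    (is "?lhs \<le> ?rhs")
proof (cases "h \<in> borel_measurable (traj_space n T)")
  case False
  \<comment> \<open>Measurability is not extracted from the Lipschitz condition: a nonmeasurable
    \<open>h\<close> is integrable under neither law, and both integrals take the default value
    0.\<close>
  have "(\<integral>x. h x \<partial>traj_law n T P A B G) = 0" for G
  proof (rule not_integrable_integral_eq)
    show "\<not> integrable (traj_law n T P A B G) h"
      using False by (auto simp: traj_law_def dest!: borel_measurable_integrable)
  qed
  moreover have "0 \<le> ?rhs"
    using h J_nn spectral_norm_nonneg[of B] \<tau>_nonneg T_pos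
    by (auto simp: traj_lipschitz_def excess_risk_eq)
  ultimately show ?thesis by simp
next
  case True
  have L: "0 \<le> L" using h by (simp add: traj_lipschitz_def)
  have b: "0 \<le> b" by (rule spectral_norm_nonneg)
  let ?f = "\<lambda>G \<omega>. \<lambda>t\<in>{1..T}. closed_loop A B G \<omega> t"
  have f: "?f G \<in> P \<rightarrow>\<^sub>M traj_space n T" if "G \<in> carrier_mat m n" for G
    unfolding traj_space_def by (intro measurable_restrict measurable_closed_loop A B that) auto
  have law: "(\<integral>x. h x \<partial>traj_law n T P A B G) = (\<integral>\<omega>. h (?f G \<omega>) \<partial>P)" if "G \<in> carrier_mat m n" for G
    unfolding traj_law_def by (rule integral_distr[OF f[OF that] True])
  have hf: "(\<lambda>\<omega>. h (?f G \<omega>)) \<in> borel_measurable P" if "G \<in> carrier_mat m n" for G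
    by (rule measurable_compose[OF f[OF that] True])
  have dist: "\<bar>h (?f K' \<omega>) - h (?f K \<omega>)\<bar> \<le> L * (2 * J * b * sqrt (4 * \<tau> * ln (Y \<omega>)))"
    if \<omega>: "\<omega> \<in> space P" for \<omega>
  proof -
    have "\<bar>h (?f K' \<omega>) - h (?f K \<omega>)\<bar> \<le> L * traj_dist T (?f K' \<omega>) (?f K \<omega>)"
      using h measurable_space[OF f[OF K] \<omega>] measurable_space[OF f[OF K'] \<omega>]
      unfolding traj_lipschitz_def by blast
    also have "\<dots> \<le> L * (2 * J * b * sqrt (4 * \<tau> * ln (Y \<omega>)))"
    proof (rule mult_left_mono[OF _ L])
      show "traj_dist T (?f K' \<omega>) (?f K \<omega>) \<le> 2 * J * b * sqrt (4 * \<tau> * ln (Y \<omega>))"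
        unfolding traj_dist_def using T_pos tracking_error_Y[OF gain \<omega>]
        by (subst Max_le_iff) auto
    qed
    finally show ?thesis .
  qed
  show ?thesis
  proof (cases "nonzero_rows = {}")
    case True
    have "?lhs \<le> (\<integral>\<omega>. 0 \<partial>P)"
      unfolding law[OF K] law[OF K']
      by (rule abs_integral_diff_le[OF hf[OF K'] hf[OF K]]) (use dist True in \<open>auto simp: \<tau>_def\<close>)
    thus ?thesis by (simp add: excess_risk_eq \<tau>_def True)
  next
    case False
    have \<tau>: "0 < \<tau>" unfolding \<tau>_def using False finite_nonzero_rows row_D_pos by (intro sum_pos)
    \<comment> \<open>Jensen's inequality is made explicit by two tangents: ln y \<le> ln a + y / a
      - 1 at the bound a for the mean of \<open>Y\<close>, and sqrt v \<le> (v / \<beta> + \<beta>)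
      / 2 at the value \<beta> that the square root takes there. The majorant \<open>g\<close> is
      then affine in \<open>Y\<close>, and its integral is at most its value at Y = a.\<close>
    define a where "a = sqrt 2 * real T"
    define \<beta> where "\<beta> = sqrt (4 * \<tau> * ln a)"
    \<comment> \<open>\<open>2 \<le> T\<close> gives 1 < a, hence ln a and \<beta> are positive and
      the division by \<beta> is legitimate.\<close>
    have "1 * 2 < sqrt 2 * real T" using T2 by (intro mult_less_le_imp_less) auto
    hence a: "1 < a" unfolding a_def by linarith
    have \<beta>: "0 < \<beta>" "\<beta>\<^sup>2 = 4 * \<tau> * ln a" using a \<tau> by (auto simp: \<beta>_def)
    define g where "g \<omega> = L * (2 * J * b) * ((4 * \<tau> * (ln a + Y \<omega> / a - 1) / \<beta> + \<beta>) / 2)" for \<omega>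
    have sqrt_le: "sqrt (4 * \<tau> * ln (Y \<omega>)) \<le> (4 * \<tau> * (ln a + Y \<omega> / a - 1) / \<beta> + \<beta>) / 2" for \<omega>
    proof -
      let ?v = "4 * \<tau> * ln (Y \<omega>)"
      have "ln (Y \<omega> / a) \<le> Y \<omega> / a - 1" using Y_ge_1[of \<omega>] a by (intro ln_le_minus_one) auto
      hence "ln (Y \<omega>) \<le> ln a + Y \<omega> / a - 1" using Y_ge_1[of \<omega>] a by (simp add: ln_div)
      hence v: "?v \<le> 4 * \<tau> * (ln a + Y \<omega> / a - 1)" using \<tau> by (intro mult_left_mono) auto
      have "0 \<le> ?v" using \<tau> Y_ge_1[of \<omega>] by simp
      hence "2 * sqrt ?v * \<beta> \<le> ?v + \<beta>\<^sup>2" using sum_squares_bound[of "sqrt ?v" \<beta>] by simp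
      also have "\<dots> \<le> 4 * \<tau> * (ln a + Y \<omega> / a - 1) + \<beta>\<^sup>2" using v by simp
      finally show ?thesis using \<beta>(1) by (simp add: field_simps power2_eq_square)
    qed
    have intY: "integrable P Y" and EY: "(\<integral>\<omega>. Y \<omega> \<partial>P) \<le> a"
      using Y_moment[OF False] by (auto simp: a_def)
    have intg: "integrable P g" unfolding g_def using intY by simp
    have "?lhs \<le> integral\<^sup>L P g"
      unfolding law[OF K] law[OF K']
    proof (rule abs_integral_diff_le[OF hf[OF K'] hf[OF K] intg])
      fix \<omega> assume "\<omega> \<in> space P"
      from dist[OF this]
      have "\<bar>h (?f K' \<omega>) - h (?f K \<omega>)\<bar> \<le> L * (2 * J * b) * sqrt (4 * \<tau> * ln (Y \<omega>))" by (simp only: mult.assoc)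
      also have "\<dots> \<le> g \<omega>"
        unfolding g_def using L J_nn b by (intro mult_left_mono sqrt_le) auto
      finally show "\<bar>h (?f K' \<omega>) - h (?f K \<omega>)\<bar> \<le> g \<omega>" .
    qed
    also have "integral\<^sup>L P g = L * (2 * J * b) * ((4 * \<tau> * (ln a + (\<integral>\<omega>. Y \<omega> \<partial>P) / a - 1) / \<beta> + \<beta>) / 2)"
      unfolding g_def using intY by (simp add: noise.prob_space)
    also have "\<dots> \<le> L * (2 * J * b) * ((4 * \<tau> * ln a / \<beta> + \<beta>) / 2)"
    proof -
      have "(\<integral>\<omega>. Y \<omega> \<partial>P) / a \<le> 1" using EY a by simp
      hence "4 * \<tau> * (ln a + (\<integral>\<omega>. Y \<omega> \<partial>P) / a - 1) / \<beta> \<le> 4 * \<tau> * ln a / \<beta>"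
        using \<tau> \<beta>(1) by (intro divide_right_mono mult_left_mono) auto
      thus ?thesis using L J_nn b by (intro mult_left_mono) auto
    qed
    also have "4 * \<tau> * ln a / \<beta> = \<beta>"
      unfolding \<beta>(2)[symmetric] using \<beta>(1) by (simp add: power2_eq_square)
    also have "L * (2 * J * b) * ((\<beta> + \<beta>) / 2) \<le> L * (2 * J * b) * (4 * (sqrt (ln (real T)) * sqrt (\<tau> / 2)))"
    proof (rule mult_left_mono)
      \<comment> \<open>The factor \<open>sqrt 2\<close> in a is absorbed by a second factor T. Then
        \<beta>^2 \<le> 8 \<tau> ln T = 16 ln T (\<tau> / 2), so \<beta> contributes 4, and the
        factor 2 of the tracking bound makes 8.\<close>
      have "sqrt 2 \<le> real T" using T2 sqrt2_less_2 by linarith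
      hence "a \<le> (real T)\<^sup>2" unfolding a_def power2_eq_square by (intro mult_right_mono) auto
      hence "ln a \<le> ln ((real T)\<^sup>2)" using a T2 by (subst ln_le_cancel_iff) auto
      hence "ln a \<le> 2 * ln (real T)" using T2 by (simp add: ln_realpow)
      hence "4 * \<tau> * ln a \<le> 16 * (ln (real T) * (\<tau> / 2))" using \<tau> by simp
      hence "\<beta> \<le> sqrt (16 * (ln (real T) * (\<tau> / 2)))" unfolding \<beta>_def by (rule real_sqrt_le_mono)
      also have "\<dots> = 4 * (sqrt (ln (real T)) * sqrt (\<tau> / 2))" by (simp only: real_sqrt_mult) simp
      finally show "(\<beta> + \<beta>) / 2 \<le> 4 * (sqrt (ln (real T)) * sqrt (\<tau> / 2))" by simp
    qed (use L J_nn b in simp)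
    also have "\<dots> = ?rhs" unfolding excess_risk_eq by simp
    finally show ?thesis .
  qed
qed

end

text \<open>The learned controller is an arbitrary fixed matrix product: the new trajectory is
  independent of the training data, so the claim is made for each value of the learned matrices. The
  smallness assumption is multiplied out and thus stays meaningful for B = 0. The restrictions on T
  and \<delta> keep the logarithms away from 0: for T = 1 the error after one step is - B D x[0],
  whereas ln T is 0 and ln (T / \<delta>) tends to 0 as \<delta> tends to 1. In the probability
  bound they enter as 2 \<le> T / \<delta>.\<close>

theorem theorem3p2:
  shows "\<exists>c>0. \<exists>C1>0. \<exists>C2>0.
    \<forall>(n::nat) (m::nat) (k::nat) (T::nat) A B F \<Phi> F' \<Phi>' \<Sigma>w \<Sigma>x (\<sigma>z::real) \<mu>x \<mu>z \<mu>w.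
      let K = F * \<Phi>;
          K' = F' * \<Phi>';
          Acl = A + B * K;
          P = noise_law T \<mu>x \<mu>z \<mu>w;
          ER = excess_risk P T A B K K'
      in
        0 < m \<longrightarrow> 0 < k \<longrightarrow> 2 * k \<le> n \<longrightarrow> 1 \<le> T \<longrightarrow>
        A \<in> carrier_mat n n \<longrightarrow> B \<in> carrier_mat n m \<longrightarrow>
        F \<in> carrier_mat m k \<longrightarrow> \<Phi> \<in> carrier_mat k n \<longrightarrow>
        F' \<in> carrier_mat m k \<longrightarrow> \<Phi>' \<in> carrier_mat k n \<longrightarrow>
        spectral_radius (map_mat complex_of_real Acl) < 1 \<longrightarrow>
        pos_def n \<Sigma>w \<longrightarrow> 0 < \<sigma>z\<^sup>2 \<longrightarrow>
        \<Sigma>x \<in> carrier_mat n n \<longrightarrow>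
        \<Sigma>x = Acl * \<Sigma>x * transpose_mat Acl + \<sigma>z\<^sup>2 \<cdot>\<^sub>m (B * transpose_mat B) + \<Sigma>w \<longrightarrow>
        centered_gaussian n \<Sigma>x \<mu>x \<longrightarrow>
        centered_gaussian m (\<sigma>z\<^sup>2 \<cdot>\<^sub>m 1\<^sub>m m) \<mu>z \<longrightarrow>
        centered_gaussian n \<Sigma>w \<mu>w \<longrightarrow>
        ER * ((\<J> Acl)\<^sup>2 * (spectral_norm B)\<^sup>2) \<le> c * lambda_min \<Sigma>x \<longrightarrow>
          (\<forall>\<delta>. 0 < \<delta> \<and> \<delta> < 1 \<and> (2 \<le> T \<or> \<delta> \<le> 1 / 2) \<longrightarrow>
             measure P {\<omega> \<in> space P.
               (MAX t\<in>{1..T}. (euclid_norm (closed_loop A B K' \<omega> t - closed_loop A B K \<omega> t))\<^sup>2)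
                 \<le> C1 * ((\<J> Acl)\<^sup>2 * (spectral_norm B)\<^sup>2 * ln (real T / \<delta>) * ER)} > 1 - \<delta>)
          \<and> (2 \<le> T \<longrightarrow> (\<forall>L h. traj_lipschitz n T L h \<longrightarrow>
               \<bar>(\<integral>x. h x \<partial>traj_law n T P A B K') - (\<integral>x. h x \<partial>traj_law n T P A B K)\<bar>
                 \<le> C2 * (L * \<J> Acl * spectral_norm B * sqrt (ln (real T)) * sqrt ER)))"
proof (unfold Let_def, rule exI[of _ "1 / 8"], rule conjI, simp, rule exI[of _ 64], rule conjI, simp,
    rule exI[of _ 8], rule conjI, simp, intro allI impI)
  fix n m k T :: nat and A B F \<Phi> F' \<Phi>' \<Sigma>w \<Sigma>x :: "real Matrix.mat" and \<sigma>z :: real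
    and \<mu>x \<mu>z \<mu>w :: "real Matrix.vec measure"
  let ?K = "F * \<Phi>" and ?K' = "F' * \<Phi>'"
  let ?P = "noise_law T \<mu>x \<mu>z \<mu>w" and ?Acl = "A + B * ?K"
  let ?ER = "excess_risk ?P T A B ?K ?K'"
  assume k: "0 < k" "2 * k \<le> n" and T: "1 \<le> T"
    and A: "A \<in> carrier_mat n n" and B: "B \<in> carrier_mat n m"
    and F: "F \<in> carrier_mat m k" "\<Phi> \<in> carrier_mat k n" and F': "F' \<in> carrier_mat m k" "\<Phi>' \<in> carrier_mat k n"
    and sr: "spectral_radius (map_mat complex_of_real ?Acl) < 1"
    and W: "pos_def n \<Sigma>w" and \<sigma>: "0 < \<sigma>z\<^sup>2" and S: "\<Sigma>x \<in> carrier_mat n n"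
    and eq: "\<Sigma>x = ?Acl * \<Sigma>x * transpose_mat ?Acl + \<sigma>z\<^sup>2 \<cdot>\<^sub>m (B * transpose_mat B) + \<Sigma>w"
    and gx: "centered_gaussian n \<Sigma>x \<mu>x" and gz: "centered_gaussian m (\<sigma>z\<^sup>2 \<cdot>\<^sub>m 1\<^sub>m m) \<mu>z"
    and gw: "centered_gaussian n \<Sigma>w \<mu>w"
    and small: "?ER * ((\<J> ?Acl)\<^sup>2 * (spectral_norm B)\<^sup>2) \<le> 1 / 8 * lambda_min \<Sigma>x"
  have n: "0 < n" using k by simp
  have K: "?K \<in> carrier_mat m n" and K': "?K' \<in> carrier_mat m n" using F F' by auto
  have M: "?Acl \<in> carrier_mat n n" using A B K by simp
  have W': "\<Sigma>w \<in> carrier_mat n n" "transpose_mat \<Sigma>w = \<Sigma>w"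
    and Wpos: "\<And>v. v \<in> carrier_vec n \<Longrightarrow> v \<noteq> 0\<^sub>v n \<Longrightarrow> 0 < v \<bullet> (\<Sigma>w *\<^sub>v v)"
    using W by (auto simp: pos_def_def)
  let ?Q = "\<sigma>z\<^sup>2 \<cdot>\<^sub>m (B * transpose_mat B) + \<Sigma>w"
  have cBB: "\<sigma>z\<^sup>2 \<cdot>\<^sub>m (B * transpose_mat B) \<in> carrier_mat n n" using B by simp
  have Q: "?Q \<in> carrier_mat n n" using cBB W'(1) by simp
  have "?Acl * \<Sigma>x * transpose_mat ?Acl \<in> carrier_mat n n"
    using M S by (meson mult_carrier_mat transpose_carrier_mat)
  from trans[OF eq assoc_add_mat[OF this cBB W'(1)]]
  have eq': "\<Sigma>x = ?Acl * \<Sigma>x * transpose_mat ?Acl + ?Q" .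
  \<comment> \<open>\<open>B * transpose_mat B\<close> may be singular; strict positivity comes from
    \<open>\<Sigma>w\<close>.\<close>
  have Qpos: "0 < v \<bullet> (?Q *\<^sub>v v)" if v: "v \<in> carrier_vec n" "v \<noteq> 0\<^sub>v n" for v
  proof -
    have "0 \<le> \<sigma>z\<^sup>2 * ((transpose_mat B *\<^sub>v v) \<bullet> (transpose_mat B *\<^sub>v v))" by (simp flip: euclid_norm_sq)
    thus ?thesis using Wpos[OF v] unfolding gram_add_form[OF B W'(1) v(1)] by linarith
  qed
  have Spos: "0 < v \<bullet> (\<Sigma>x *\<^sub>v v)" if "v \<in> carrier_vec n" "v \<noteq> 0\<^sub>v n" for v
    by (rule lyapunov_pos_def[OF M S Q n sr eq']) (fact Qpos that)+
  note Ssym = lyapunov_symmetric[OF M S Q n sr eq' gram_add_symmetric[OF B W']]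
  have noise: "prob_space \<mu> \<and> sets \<mu> = sets (borel_vec d)" if "centered_gaussian d X \<mu>" for d X \<mu>
    using that unfolding centered_gaussian_def by blast
  interpret process_noise n m T \<mu>x \<mu>z \<mu>w
    by (rule process_noise.intro) (use noise[OF gx] noise[OF gz] noise[OF gw] in blast)+
  have X: "normal_rv \<mu>x (\<lambda>x. a \<bullet> x) (a \<bullet> (\<Sigma>x *\<^sub>v a))" if "a \<in> carrier_vec n" for a
    by (rule centered_gaussian_functional[OF gx S]) (fact Spos that)+
  have W: "normal_rv \<mu>w (\<lambda>x. a \<bullet> x) (a \<bullet> (\<Sigma>w *\<^sub>v a))" if "a \<in> carrier_vec n" for a
    by (rule centered_gaussian_functional[OF gw W'(1)]) (fact Wpos that)+
  have Z: "normal_rv \<mu>z (\<lambda>x. a \<bullet> x) (\<sigma>z\<^sup>2 * (a \<bullet> a))" if a: "a \<in> carrier_vec m" for a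
  proof -
    have form: "v \<bullet> ((\<sigma>z\<^sup>2 \<cdot>\<^sub>m 1\<^sub>m m) *\<^sub>v v) = \<sigma>z\<^sup>2 * (v \<bullet> v)" if "v \<in> carrier_vec m" for v :: "real Matrix.vec"
      using that by (simp add: smult_mat_mult_vec[of _ m m])
    have pos: "0 < v \<bullet> ((\<sigma>z\<^sup>2 \<cdot>\<^sub>m 1\<^sub>m m) *\<^sub>v v)" if v: "v \<in> carrier_vec m" "v \<noteq> 0\<^sub>v m" for v
    proof -
      have "euclid_norm v \<noteq> 0" using euclid_norm_eq_0[OF v(1)] v(2) by simp
      hence "0 < v \<bullet> v" by (simp flip: euclid_norm_sq)
      thus ?thesis unfolding form[OF v(1)] using \<sigma> by simp
    qed
    from centered_gaussian_functional[OF gz _ pos a] show ?thesis unfolding form[OF a] by simp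
  qed
  interpret closed_loop_comparison n m T \<mu>x \<mu>z \<mu>w A B ?K ?K' \<Sigma>x \<Sigma>w "\<sigma>z\<^sup>2"
    by unfold_locales (fact n T A B K K' S W'(1) sr eq Ssym Spos X Z W)+
  have gain: "J * b * frobenius_norm D \<le> 1 / 2" by (rule loop_gain[OF small])
  have "2 \<le> real T / \<delta>" if "0 < \<delta> \<and> \<delta> < 1 \<and> (2 \<le> T \<or> \<delta> \<le> 1 / 2)" for \<delta>
  proof -
    have "2 * \<delta> \<le> real T" using that T by (cases "2 \<le> T") auto
    thus ?thesis using that by (simp add: field_simps)
  qed
  thus "(\<forall>\<delta>. 0 < \<delta> \<and> \<delta> < 1 \<and> (2 \<le> T \<or> \<delta> \<le> 1 / 2) \<longrightarrow>
         measure ?P {\<omega> \<in> space ?P.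
           (MAX t\<in>{1..T}. (euclid_norm (closed_loop A B ?K' \<omega> t - closed_loop A B ?K \<omega> t))\<^sup>2)
             \<le> 64 * ((\<J> ?Acl)\<^sup>2 * (spectral_norm B)\<^sup>2 * ln (real T / \<delta>) * ?ER)} > 1 - \<delta>)
      \<and> (2 \<le> T \<longrightarrow> (\<forall>L h. traj_lipschitz n T L h \<longrightarrow>
           \<bar>(\<integral>x. h x \<partial>traj_law n T ?P A B ?K') - (\<integral>x. h x \<partial>traj_law n T ?P A B ?K)\<bar>
             \<le> 8 * (L * \<J> ?Acl * spectral_norm B * sqrt (ln (real T)) * sqrt ?ER)))"
    using tracking_high_probability[OF gain] lipschitz_expectation[OF gain] by blast
qed

end
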